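(* Let $(A_t)_{t\ge0}$ be the continuous-time diffusion limited aggregation process on $\mathcal{H}$. For every integer $m\ge1$ and every $t\ge0$, $$E\big[\|A_t\|^m\big]<\infty.$$
   Context: $\mathcal{H}=\{(x_1,x_2)\in\mathbb{Z}^2: x_2\ge 0\}$; $L_n=\{(k,n):k\in\mathbb{Z}\}$ for integers $n\ge 0$. For $x\in\mathbb{Z}^2$, $\|x\|=|x_1|+|x_2|$, and for finite $A$, $\|A\|=\max\{\|x\|:x\in A\}$. $(S_n)_{n\ge 0}$ is simple random walk on $\mathbb{Z}^2$, $P_z$ is its law when $S_0=z$, and for $A\subset\mathbb{Z}^2$, $\bar\tau_A=\min\{n\ge 0:S_n\in A\}$. For $B\subset\mathcal{H}$ and an oriented nearest-neighbor edge $\vec e=x\to y$ with $x\in B$, $y\in\mathcal{H}\setminus B$, let $$H_{B,N}(\vec e)=\sum_{z\in L_N\setminus B}P_z\big(S_{\bar\tau_{B\cup L_0}}=x,\ S_{\bar\tau_{B\cup L_0}-1}=y\big),\qquad H_B(\vec e)=\lim_{N\to\infty}H_{B,N}(\vec e)$$ (the limit exists and is finite). Let $\partial^{out}B$ be the set of points of $\mathcal H\setminus B$ having a nearest neighbor in $B$. For $y\in\partial^{out}B$ let $\hat H_B(y)=\sum_{\vec e}H_B(\vec e)$, the sum over edges $\vec e$ starting in $B$ and ending at $y$ (and $\hat H_B(y)=0$ for other $y$). For finite $B$, $H_B=\sum_{y\in\partial^{out}B}\hat H_B(y)$. The process $A_t$ is the continuous-time pure jump Markov process on finite subsets of $\mathcal{H}$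 with $A_0=\{(0,0)\}$ which grows at rate $H_{A_t}$, and at each growth time adds to the current set $A_t$ one new point $y\in\partial^{out}A_t$ chosen with probability $\tilde p(A_t,y)=\hat H_{A_t}(y)/H_{A_t}$ (equivalently, $A\to A\cup\{y\}$ at rate $\hat H_A(y)$). This process almost surely does not explode, so it is defined for all $t\in[0,\infty)$. *)

theory Defs
  imports "HOL-Probability.Probability"
begin

type_synonym pt = "int \<times> int"

definition half_plane :: "pt set" where
  "half_plane = {x. snd x \<ge> 0}"

definition level :: "nat \<Rightarrow> pt set" where
  "level n = {(k, int n) | k. True}"

definition pt_norm :: "pt \<Rightarrow> nat" where
  "pt_norm x = nat (\<bar>fst x\<bar> + \<bar>snd x\<bar>)"

text \<open>Only meaningful for finite nonempty sets.\<close>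

definition set_norm :: "pt set \<Rightarrow> nat" where
  "set_norm A = Max (pt_norm ` A)"

definition adjacent :: "pt \<Rightarrow> pt \<Rightarrow> bool" where
  "adjacent x y \<longleftrightarrow> pt_norm (x - y) = 1"

definition outer_boundary :: "pt set \<Rightarrow> pt set" where
  "outer_boundary B = {y \<in> half_plane - B. \<exists>x\<in>B. adjacent x y}"

text \<open>
  The sample space of simple random walk consists of the streams of independent uniform unit steps;
  the law of the walk from z is that of \<open>walk z \<omega>\<close> for \<open>\<omega>\<close> distributed according to \<open>steps\<close>.
\<close>

definition steps :: "pt stream measure" where
  "steps = stream_space (measure_pmf (pmf_of_set {(1, 0), (-1, 0), (0, 1), (0, -1)}))"

definition walk :: "pt \<Rightarrow> pt stream \<Rightarrow> nat \<Rightarrow> pt" where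
  "walk z \<omega> n = z + (\<Sum>i<n. \<omega> !! i)"

text \<open>The infimum of the empty set is \<open>\<infinity>\<close>: the set is never hit.\<close>

definition hit_time :: "pt set \<Rightarrow> (nat \<Rightarrow> pt) \<Rightarrow> enat" where
  "hit_time A S = Inf {enat n | n. S n \<in> A}"

text \<open>
  An oriented edge from x to y is given by the two arguments x and y. It starts in B; the walk
  traverses it backwards, from y to x, in the step in which it first hits B or level 0.
\<close>

definition edge_harm_N :: "pt set \<Rightarrow> nat \<Rightarrow> pt \<Rightarrow> pt \<Rightarrow> real" where
  "edge_harm_N B N x y =
     (\<Sum>\<^sub>\<infinity> z \<in> level N - B.
        measure steps {\<omega> \<in> space steps.
          \<exists>n. hit_time (B \<union> level 0) (walk z \<omega>) = enat (Suc n)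
            \<and> walk z \<omega> (Suc n) = x \<and> walk z \<omega> n = y})"

definition edge_harm :: "pt set \<Rightarrow> pt \<Rightarrow> pt \<Rightarrow> real" where
  "edge_harm B x y = lim (\<lambda>N. edge_harm_N B N x y)"

definition point_harm :: "pt set \<Rightarrow> pt \<Rightarrow> real" where
  "point_harm B y =
     (if y \<in> outer_boundary B then \<Sum>x | x \<in> B \<and> adjacent x y. edge_harm B x y else 0)"

definition total_harm :: "pt set \<Rightarrow> real" where
  "total_harm B = (\<Sum>y\<in>outer_boundary B. point_harm B y)"

definition growth_prob :: "pt set \<Rightarrow> pt \<Rightarrow> real" where
  "growth_prob A y = point_harm A y / total_harm A"

text \<open>At most one y contributes to the sum.\<close>

definition jump_prob :: "pt set \<Rightarrow> pt set \<Rightarrow> real" where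
  "jump_prob A A' = (\<Sum>y | y \<in> outer_boundary A \<and> A' = insert y A. growth_prob A y)"

definition clusters :: "pt set set" where
  "clusters = {A. finite A \<and> A \<subseteq> half_plane}"

text \<open>
  Y is the sequence of successive states and T n the time spent in Y n. The joint law says that
  Y is a Markov chain started in the singleton of the origin with transition probabilities
  \<open>jump_prob\<close>, and that conditionally on Y the holding times are independent, T n being
  exponential with parameter \<open>total_harm (Y n)\<close>.
\<close>

definition jump_chain_holding_times ::
  "'w measure \<Rightarrow> (nat \<Rightarrow> 'w \<Rightarrow> pt set) \<Rightarrow> (nat \<Rightarrow> 'w \<Rightarrow> real) \<Rightarrow> bool" where
  "jump_chain_holding_times M Y T \<longleftrightarrow>
     (\<forall>n. Y n \<in> measurable M (count_space clusters)) \<and>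
     (\<forall>n. T n \<in> borel_measurable M) \<and>
     (\<forall>n a s. (\<forall>i<n. s i \<ge> 0) \<longrightarrow>
        measure M {\<omega> \<in> space M. (\<forall>i\<le>n. Y i \<omega> = a i) \<and> (\<forall>i<n. T i \<omega> > s i)} =
        (if a 0 = {(0, 0)} then 1 else 0) *
        (\<Prod>i<n. jump_prob (a i) (a (Suc i)) * exp (- total_harm (a i) * s i)))"

text \<open>
  The process sits in Y n from the time of the n-th jump up to, but excluding, the time of the
  next one. Nothing is assumed about explosion: were the sum of all holding times at most t with
  positive probability, the value of A t on that event would be an arbitrary cluster.
\<close>

definition ct_dla :: "'w measure \<Rightarrow> (real \<Rightarrow> 'w \<Rightarrow> pt set) \<Rightarrow> bool" where
  "ct_dla M A \<longleftrightarrow>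
     prob_space M \<and>
     (\<forall>t\<ge>0. A t \<in> measurable M (count_space clusters)) \<and>
     (\<exists>Y T. jump_chain_holding_times M Y T \<and>
        (AE \<omega> in M. \<forall>t\<ge>0. \<forall>n.
           (\<Sum>i<n. T i \<omega>) \<le> t \<and> t < (\<Sum>i<Suc n. T i \<omega>) \<longrightarrow> A t \<omega> = Y n \<omega>))"

end

(*
  Two ingredients. First, the total growth rate of a cluster contained in the half-disc of radius n
  is O(n), because the probability to hit a box of side R before the axis is at most a constant times
  the probability to reach the axis within distance 4R of the origin, and the latter sums to
  O(R) over every horizontal line. The same decomposition along a line shows that the flux through
  an edge does not depend on the height N of the starting line once N exceeds the cluster; so the limit
  exists, and the total rate is positive (enter from just above a highest point). Secondly, after
  n jumps the norm is at most n, so the jump times dominate those of a Yule type process with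
  rates O(n): the n-th jump occurs before t with probability O(n^(-k)) for every k.
*)

theory Submission
  imports Defs
begin

section \<open>Neighbour averages and the hitting distribution of a line\<close>

text \<open>Rates are limits of infinite sums over starting points. Hitting probabilities therefore
  live in \<open>ennreal\<close>, where sums may be exchanged and monotone limits taken freely;
  reals return once the flux is known to be finite. The walk enters through its first-step
  decomposition: the hitting law of a line is built by iterating neighbour averages, and what the
  strong Markov property would give follows by comparing truncated iterates. For rates linear in the
  radius all edges must be bounded at once, using that the walk enters the cluster through a single
  edge. The holding times are given only by joint tails along prescribed paths. A Chernoff bound is
  therefore made from step-function weights and summed over the finitely many growth paths. Decay of
  order \<open>k = m + 2\<close> makes \<open>n ^ m\<close> times the probability that
  \<open>n\<close> jumps have occurred by time \<open>t\<close> summable; the same bound yields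
  non-explosion by Borel-Cantelli.\<close>

definition unit_steps :: "pt set" where
  "unit_steps = {(1, 0), (-1, 0), (0, 1), (0, -1)}"

lemma finite_unit_steps [simp]: "finite unit_steps"
  and card_unit_steps: "card unit_steps = 4"
  and unit_steps_nonempty: "unit_steps \<noteq> {}"
  by (simp_all add: unit_steps_def)

lemma sum_unit_steps:
  fixes f :: "pt \<Rightarrow> 'a::comm_monoid_add"
  shows "(\<Sum>s\<in>unit_steps. f s) = f (1, 0) + f (-1, 0) + f (0, 1) + f (0, -1)"
  by (simp add: unit_steps_def add.assoc)

definition nbr_mean :: "(pt \<Rightarrow> ennreal) \<Rightarrow> pt \<Rightarrow> ennreal" where
  "nbr_mean f z = (\<Sum>s\<in>unit_steps. f (z + s)) / 4"

lemma nbr_mean_mono: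
  assumes "\<And>s. s \<in> unit_steps \<Longrightarrow> f (z + s) \<le> g (z + s)"
  shows "nbr_mean f z \<le> nbr_mean g z"
  unfolding nbr_mean_def by (intro divide_right_mono_ennreal sum_mono assms)

lemma nbr_mean_cong:
  assumes "\<And>s. s \<in> unit_steps \<Longrightarrow> f (z + s) = g (z + s)"
  shows "nbr_mean f z = nbr_mean g z"
  by (intro antisym nbr_mean_mono) (simp_all add: assms)

lemma nbr_mean_cmult: "nbr_mean (\<lambda>z. c * f z) z = c * nbr_mean f z"
  by (simp add: nbr_mean_def sum_distrib_left ennreal_times_divide)

lemma nbr_mean_translate: "nbr_mean (\<lambda>u. f (u - w)) z = nbr_mean f (z - w)"
  by (simp add: nbr_mean_def add_diff_eq diff_add_eq)

lemma nbr_mean_sum: "nbr_mean (\<lambda>z. \<Sum>i\<in>I. f i z) z = (\<Sum>i\<in>I. nbr_mean (f i) z)"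
proof -
  have "nbr_mean (\<lambda>z. \<Sum>i\<in>I. f i z) z = (\<Sum>i\<in>I. \<Sum>s\<in>unit_steps. f i (z + s)) / 4"
    unfolding nbr_mean_def by (subst sum.swap) simp
  also have "\<dots> = (\<Sum>i\<in>I. nbr_mean (f i) z)"
    by (simp add: nbr_mean_def divide_ennreal_def sum_distrib_right)
  finally show ?thesis .
qed

lemma nbr_mean_nn_integral:
  "nbr_mean (\<lambda>z. \<integral>\<^sup>+k. f k z \<partial>count_space UNIV) z = (\<integral>\<^sup>+k. nbr_mean (f k) z \<partial>count_space UNIV)"
  by (simp add: nbr_mean_def nn_integral_divide nn_integral_sum)

lemma nbr_mean_SUP:
  assumes "\<And>z. incseq (\<lambda>n. f n z)"
  shows "nbr_mean (\<lambda>z. SUP n. f n z) z = (SUP n. nbr_mean (f n) z)"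
proof -
  have "(\<Sum>s\<in>unit_steps. SUP n. f n (z + s)) = (SUP n. \<Sum>s\<in>unit_steps. f n (z + s))"
    by (rule ennreal_SUP_sum[symmetric]) (use assms in auto)
  then show ?thesis
    by (simp add: nbr_mean_def divide_ennreal_def SUP_mult_right_ennreal)
qed

text \<open>Value iteration for the Dirichlet problem with value 1 at the origin and 0 elsewhere on
  the closed lower half-plane: the chance of absorption at the origin within \<open>n\<close>
  steps.\<close>

primrec line_hit_upto :: "nat \<Rightarrow> pt \<Rightarrow> ennreal" where
  "line_hit_upto 0 z = (if z = 0 then 1 else 0)"
| "line_hit_upto (Suc n) z =
     (if snd z \<le> 0 then if z = 0 then 1 else 0 else nbr_mean (line_hit_upto n) z)"

definition line_hit :: "pt \<Rightarrow> ennreal" where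
  \<comment> \<open>the probability that simple random walk from z first hits the horizontal axis at the origin\<close>
  "line_hit z = (SUP n. line_hit_upto n z)"

lemma line_hit_upto_Suc_mono: "line_hit_upto n z \<le> line_hit_upto (Suc n) z"
proof (induction n arbitrary: z)
  case 0
  then show ?case by simp
next
  case (Suc n)
  have "nbr_mean (line_hit_upto n) z \<le> nbr_mean (line_hit_upto (Suc n)) z"
    by (intro nbr_mean_mono Suc)
  then show ?case
    unfolding line_hit_upto.simps(2)[of "Suc n" z] line_hit_upto.simps(2)[of n z] by simp
qed

lemma incseq_line_hit_upto: "incseq (\<lambda>n. line_hit_upto n z)"
  using line_hit_upto_Suc_mono by (intro incseq_SucI)

lemma line_hit_boundary: "snd z \<le> 0 \<Longrightarrow> line_hit z = (if z = 0 then 1 else 0)"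
proof -
  assume z: "snd z \<le> 0"
  have "line_hit_upto n z = (if z = 0 then 1 else 0)" for n
    using z by (cases n) auto
  then show ?thesis by (simp add: line_hit_def)
qed

lemma line_hit_harmonic:
  assumes "snd z > 0"
  shows "line_hit z = nbr_mean line_hit z"
proof -
  have "(SUP n. line_hit_upto n z) = (SUP n. line_hit_upto (Suc n) z)"
  proof (rule antisym)
    show "(SUP n. line_hit_upto n z) \<le> (SUP n. line_hit_upto (Suc n) z)"
      using line_hit_upto_Suc_mono by (intro SUP_mono) blast
    show "(SUP n. line_hit_upto (Suc n) z) \<le> (SUP n. line_hit_upto n z)"
      by (intro SUP_mono) blast
  qed
  also have "\<dots> = (SUP n. nbr_mean (line_hit_upto n) z)"
    using assms by simp
  also have "\<dots> = nbr_mean line_hit z"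
    unfolding line_hit_def by (rule nbr_mean_SUP[symmetric]) (rule incseq_line_hit_upto)
  finally show ?thesis by (simp add: line_hit_def)
qed

lemma nn_integral_int_shift:
  fixes f :: "int \<Rightarrow> ennreal"
  shows "(\<integral>\<^sup>+k. f (k + a) \<partial>count_space UNIV) = (\<integral>\<^sup>+k. f k \<partial>count_space UNIV)"
proof (rule nn_integral_bij_count_space)
  show "bij_betw (\<lambda>k. k + a) UNIV UNIV"
    by (rule bij_betwI[of _ _ _ "\<lambda>k. k - a"]) auto
qed

lemma nn_integral_origin:
  "(\<integral>\<^sup>+k. (if (k, 0) = (0::pt) then 1 else 0) \<partial>count_space UNIV) = 1"
proof -
  have "(\<integral>\<^sup>+k. (if (k, 0) = (0::pt) then 1 else 0 :: ennreal) \<partial>count_space UNIV)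
      = (\<Sum>k\<in>{0}. (if (k, 0) = (0::pt) then 1 else 0))"
    by (rule nn_integral_count_space') (auto simp: zero_prod_def)
  then show ?thesis by (simp add: zero_prod_def)
qed

lemma nn_integral_row_mean:
  "(\<integral>\<^sup>+k. nbr_mean f (k, h) \<partial>count_space UNIV) =
    (2 * (\<integral>\<^sup>+k. f (k, h) \<partial>count_space UNIV) + (\<integral>\<^sup>+k. f (k, h + 1) \<partial>count_space UNIV)
      + (\<integral>\<^sup>+k. f (k, h - 1) \<partial>count_space UNIV)) / 4"
proof -
  have "(\<integral>\<^sup>+k. nbr_mean f (k, h) \<partial>count_space UNIV)
    = ((\<integral>\<^sup>+k. f (k + 1, h) \<partial>count_space UNIV) + (\<integral>\<^sup>+k. f (k + -1, h) \<partial>count_space UNIV)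
      + (\<integral>\<^sup>+k. f (k, h + 1) \<partial>count_space UNIV)
      + (\<integral>\<^sup>+k. f (k, h - 1) \<partial>count_space UNIV)) / 4"
    by (simp add: nbr_mean_def sum_unit_steps nn_integral_divide nn_integral_add)
  then show ?thesis
    using nn_integral_int_shift[of "\<lambda>k. f (k, h)" 1] nn_integral_int_shift[of "\<lambda>k. f (k, h)" "-1"]
    by (simp add: mult_2)
qed

text \<open>By translation, summing over starts in one row amounts to summing over landing points
  for one start. Averaging weighs the same row by 2/4 and each adjacent row by 1/4, so the bound 1
  survives each iteration.\<close>

lemma line_hit_upto_row_le_1: "(\<integral>\<^sup>+k. line_hit_upto n (k, h) \<partial>count_space UNIV) \<le> 1"
proof (induction n arbitrary: h)
  case 0
  show ?case
  proof (cases "h = 0")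
    case True
    then show ?thesis using nn_integral_origin by simp
  qed (simp add: zero_prod_def)
next
  case (Suc n)
  consider "h < 0" | "h = 0" | "h > 0" by linarith
  then show ?case
  proof cases
    case 3
    then have "(\<integral>\<^sup>+k. line_hit_upto (Suc n) (k, h) \<partial>count_space UNIV) =
        (\<integral>\<^sup>+k. nbr_mean (line_hit_upto n) (k, h) \<partial>count_space UNIV)" by simp
    also have "\<dots> \<le> (2 * 1 + 1 + 1) / 4"
      unfolding nn_integral_row_mean
      by (intro divide_right_mono_ennreal add_mono mult_left_mono Suc) auto
    also have "\<dots> = (1::ennreal)"
      using ennreal_divide_self[of 4] by simp
    finally show ?thesis .
  qed (use nn_integral_origin in \<open>simp_all add: zero_prod_def\<close>)
qed

lemma line_hit_row_le_1: "(\<integral>\<^sup>+k. line_hit (k, h) \<partial>count_space UNIV) \<le> 1"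
proof -
  have "(\<integral>\<^sup>+k. line_hit (k, h) \<partial>count_space UNIV)
      = (SUP n. \<integral>\<^sup>+k. line_hit_upto n (k, h) \<partial>count_space UNIV)"
    unfolding line_hit_def
    by (rule nn_integral_monotone_convergence_SUP)
      (auto intro!: incseq_SucI le_funI line_hit_upto_Suc_mono simp del: line_hit_upto.simps)
  also have "\<dots> \<le> 1" by (intro SUP_least line_hit_upto_row_le_1)
  finally show ?thesis .
qed

lemma line_hit_le_1: "line_hit z \<le> 1"
proof -
  obtain k h where z: "z = (k, h)" by (cases z)
  have "line_hit (k, h) = (\<integral>\<^sup>+j. line_hit (j, h) * indicator {k} j \<partial>count_space UNIV)"
    by (subst nn_integral_indicator_singleton) auto
  also have "\<dots> \<le> (\<integral>\<^sup>+j. line_hit (j, h) \<partial>count_space UNIV)"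
    by (intro nn_integral_mono) (auto split: split_indicator)
  finally show ?thesis using line_hit_row_le_1[of h] z by simp
qed

text \<open>Recurrence: the row sums are a bounded harmonic function of the height, hence constant.\<close>

lemma line_hit_row_sum: "(\<integral>\<^sup>+k. line_hit (k, int n) \<partial>count_space UNIV) = 1"
proof -
  define F where "F = (\<lambda>h. \<integral>\<^sup>+k. line_hit (k, h) \<partial>count_space UNIV)"
  define f where "f = (\<lambda>n. enn2real (F (int n)))"
  have F1: "F h \<le> 1" for h unfolding F_def by (rule line_hit_row_le_1)
  have Ff: "F (int n) = ennreal (f n)" for n
    unfolding f_def using F1[of "int n"] by (subst ennreal_enn2real) (auto simp: le_less_trans)
  have f0: "0 \<le> f n" and f1: "f n \<le> 1" for n
    using F1[of "int n"] by (auto simp: f_def intro!: enn2real_leI)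
  have "F 0 = 1"
    using nn_integral_origin by (simp add: F_def line_hit_boundary)
  then have z: "f 0 = 1" by (simp add: f_def)
  have rec: "2 * f (Suc n) = f n + f (Suc (Suc n))" for n
  proof -
    have "F (int (Suc n)) = (\<integral>\<^sup>+k. nbr_mean line_hit (k, int (Suc n)) \<partial>count_space UNIV)"
      unfolding F_def by (intro nn_integral_cong line_hit_harmonic) simp
    also have "\<dots> = (2 * F (int (Suc n)) + F (int (Suc (Suc n))) + F (int n)) / 4"
      unfolding nn_integral_row_mean F_def by (simp add: add.commute)
    finally have "ennreal (f (Suc n)) = ennreal ((2 * f (Suc n) + f (Suc (Suc n)) + f n) / 4)"
      unfolding Ff using f0
      by (simp add: ennreal_plus[symmetric] ennreal_mult'[symmetric] divide_ennreal[symmetric]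
          ennreal_numeral[symmetric] del: ennreal_plus ennreal_numeral)
    then have "f (Suc n) = (2 * f (Suc n) + f (Suc (Suc n)) + f n) / 4"
      using f0 by (subst (asm) ennreal_inj) auto
    then show ?thesis by simp
  qed
  have lin: "f n = 1 - real n * (1 - f 1) \<and> f (Suc n) = 1 - real (Suc n) * (1 - f 1)" for n
  proof (induction n)
    case (Suc n)
    then show ?case using rec[of n] by (auto simp: algebra_simps)
  qed (use z in simp)
  have "1 - f 1 \<le> 0"
  proof (rule ccontr)
    assume "\<not> 1 - f 1 \<le> 0"
    then obtain n where "1 < real n * (1 - f 1)"
      using reals_Archimedean3[of "1 - f 1"] by force
    then show False using lin[of n] f0[of n] by simp
  qed
  then have "f 1 = 1" using f1[of 1] by simp
  then have "f n = 1" using lin[of n] by simp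
  then show ?thesis using Ff[of n] by (simp add: F_def)
qed

section \<open>The probability of entering through a given edge\<close>

lemma hit_time_eq_enat_iff: "hit_time A S = enat n \<longleftrightarrow> S n \<in> A \<and> (\<forall>i<n. S i \<notin> A)"
proof
  assume h: "hit_time A S = enat n"
  have "{enat n | n. S n \<in> A} \<noteq> {}"
  proof
    assume e: "{enat n | n. S n \<in> A} = {}"
    have "hit_time A S = \<infinity>" unfolding hit_time_def e by (simp add: top_enat_def)
    then show False using h by simp
  qed
  then have "Inf {enat n | n. S n \<in> A} \<in> {enat n | n. S n \<in> A}"
    by (metis (no_types, lifting) ex_in_conv wellorder_InfI)
  then have 1: "S n \<in> A" using h by (auto simp: hit_time_def)
  have "S i \<notin> A" if "i < n" for i
  proof
    assume "S i \<in> A"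
    then have "hit_time A S \<le> enat i" unfolding hit_time_def by (intro Inf_lower) auto
    then show False using h that by simp
  qed
  with 1 show "S n \<in> A \<and> (\<forall>i<n. S i \<notin> A)" by blast
next
  assume h: "S n \<in> A \<and> (\<forall>i<n. S i \<notin> A)"
  show "hit_time A S = enat n" unfolding hit_time_def
  proof (rule antisym)
    show "Inf {enat n | n. S n \<in> A} \<le> enat n" using h by (intro Inf_lower) auto
    show "enat n \<le> Inf {enat n | n. S n \<in> A}" using h
      by (intro Inf_greatest) (auto simp: not_less[symmetric])
  qed
qed

lemma walk_0 [simp]: "walk z \<omega> 0 = z"
  by (simp add: walk_def)

lemma walk_SCons: "walk z (s ## \<omega>) (Suc n) = walk (z + s) \<omega> n"
  by (simp add: walk_def sum.lessThan_Suc_shift add.assoc del: sum.lessThan_Suc)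

lemma measurable_walk [measurable]: "(\<lambda>\<omega>. walk z \<omega> n) \<in> measurable steps (count_space UNIV)"
proof (induction n)
  case (Suc n)
  have [measurable]: "(\<lambda>\<omega>. \<omega> !! n) \<in> measurable steps (count_space UNIV)"
  proof -
    let ?p = "measure_pmf (pmf_of_set {(1, 0), (-1, 0), (0, 1), (0, -1)}) :: pt measure"
    have "(\<lambda>\<omega>. \<omega> !! n) \<in> measurable steps ?p"
      unfolding steps_def by (rule measurable_snth)
    also have "measurable steps ?p = measurable steps (count_space UNIV)"
      by (rule measurable_cong_sets) simp_all
    finally show ?thesis .
  qed
  note [measurable] = Suc
  have "(\<lambda>\<omega>. (\<lambda>a \<omega>. a + \<omega> !! n) (walk z \<omega> n) \<omega>) \<in> measurable steps (count_space UNIV)"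
    by (rule measurable_compose_countable) measurable
  then show ?case by (simp add: walk_def add.assoc)
qed simp

interpretation steps: prob_space steps
  unfolding steps_def by (rule prob_space.prob_space_stream_space) (rule measure_pmf.prob_space_axioms)

lemma space_steps [simp]: "space steps = UNIV"
  by (simp add: steps_def space_stream_space)

text \<open>Independence of the first step from the remaining ones enters here.\<close>

lemma emeasure_steps:
  assumes "X \<in> sets steps"
  shows "emeasure steps X = (\<Sum>s\<in>unit_steps. emeasure steps {\<omega>. s ## \<omega> \<in> X}) / 4"
proof -
  have "emeasure steps X = (\<integral>\<^sup>+s. emeasure steps {\<omega> \<in> space steps. s ## \<omega> \<in> X}
      \<partial>measure_pmf (pmf_of_set unit_steps))"
    using assms unfolding steps_def unit_steps_def
    by (intro prob_space.emeasure_stream_space measure_pmf.prob_space_axioms)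
  then show ?thesis
    by (simp add: nn_integral_pmf_of_set unit_steps_nonempty card_unit_steps)
qed

text \<open>With \<open>m = \<infinity>\<close> this is the event in the definition of \<open>edge_harm_N\<close>.\<close>

definition edge_event :: "pt set \<Rightarrow> pt \<Rightarrow> pt \<Rightarrow> enat \<Rightarrow> pt \<Rightarrow> pt stream set" where
  "edge_event B x y m z = {\<omega> \<in> space steps. \<exists>n. enat n < m \<and>
     hit_time (B \<union> level 0) (walk z \<omega>) = enat (Suc n) \<and> walk z \<omega> (Suc n) = x \<and> walk z \<omega> n = y}"

definition edge_prob :: "pt set \<Rightarrow> pt \<Rightarrow> pt \<Rightarrow> enat \<Rightarrow> pt \<Rightarrow> ennreal" where
  "edge_prob B x y m z = emeasure steps (edge_event B x y m z)"

lemma sets_edge_event [measurable]: "edge_event B x y m z \<in> sets steps"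
  unfolding edge_event_def hit_time_eq_enat_iff by measurable

text \<open>Prepending a step shifts the clock by one: index 0 is a first step that already
  traverses the edge, index \<open>Suc n\<close> is index \<open>n\<close> of the remaining
  walk.\<close>

lemma edge_event_SCons:
  "s ## \<omega> \<in> edge_event B x y (eSuc m) z \<longleftrightarrow> z \<notin> B \<union> level 0 \<and>
    (z = y \<and> z + s = x \<and> x \<in> B \<union> level 0 \<or> \<omega> \<in> edge_event B x y m (z + s))"
proof -
  let ?K = "B \<union> level 0"
  let ?P = "\<lambda>m z \<omega> n. enat n < m \<and> (walk z \<omega> (Suc n) \<in> ?K \<and> (\<forall>i<Suc n. walk z \<omega> i \<notin> ?K)) \<and>
      walk z \<omega> (Suc n) = x \<and> walk z \<omega> n = y"
  define P where "P = ?P"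
  have all: "s ## \<omega> \<in> edge_event B x y (eSuc m) z \<longleftrightarrow> (\<exists>n. P (eSuc m) z (s ## \<omega>) n)"
    and tail: "\<omega> \<in> edge_event B x y m (z + s) \<longleftrightarrow> (\<exists>n. P m (z + s) \<omega> n)"
    by (simp_all add: P_def edge_event_def hit_time_eq_enat_iff)
  have first: "P (eSuc m) z (s ## \<omega>) 0 \<longleftrightarrow> z \<notin> ?K \<and> z = y \<and> z + s = x \<and> x \<in> ?K"
    by (auto simp: P_def walk_SCons zero_enat_def[symmetric])
  have later: "P (eSuc m) z (s ## \<omega>) (Suc n) \<longleftrightarrow> z \<notin> ?K \<and> P m (z + s) \<omega> n" for n
  proof -
    have a: "enat (Suc n) < eSuc m \<longleftrightarrow> enat n < m" by (simp add: eSuc_enat[symmetric])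
    show ?thesis
      unfolding P_def a walk_SCons All_less_Suc2[of "Suc n"] by auto
  qed
  have "(\<exists>n. P (eSuc m) z (s ## \<omega>) n) \<longleftrightarrow>
      P (eSuc m) z (s ## \<omega>) 0 \<or> (\<exists>n. P (eSuc m) z (s ## \<omega>) (Suc n))"
    by (metis not0_implies_Suc)
  then show ?thesis
    unfolding all tail first later by blast
qed

lemma edge_event_start: "z \<in> B \<union> level 0 \<Longrightarrow> edge_event B x y m z = {}"
  by (auto simp: edge_event_def hit_time_eq_enat_iff)

lemma edge_prob_start: "z \<in> B \<union> level 0 \<Longrightarrow> edge_prob B x y m z = 0"
  by (simp add: edge_prob_def edge_event_start)

lemma edge_prob_0: "edge_prob B x y 0 z = 0"
  by (simp add: edge_prob_def edge_event_def)

text \<open>As \<open>eSuc \<infinity> = \<infinity>\<close>, one identity is both the recursion for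
  the truncated probabilities and the Poisson equation for the untruncated one.\<close>

lemma edge_prob_eSuc:
  assumes z: "z \<notin> B \<union> level 0"
  shows "edge_prob B x y (eSuc m) z =
    nbr_mean (\<lambda>u. (if z = y \<and> u = x \<and> x \<in> B \<union> level 0 then 1 else 0) + edge_prob B x y m u) z"
proof -
  have "emeasure steps {\<omega>. s ## \<omega> \<in> edge_event B x y (eSuc m) z} =
    (if z = y \<and> z + s = x \<and> x \<in> B \<union> level 0 then 1 else 0) + edge_prob B x y m (z + s)" for s
  proof (cases "z = y \<and> z + s = x \<and> x \<in> B \<union> level 0")
    case True
    then have "{\<omega>. s ## \<omega> \<in> edge_event B x y (eSuc m) z} = space steps"
      using z by (auto simp: edge_event_SCons)
    moreover have "edge_prob B x y m (z + s) = 0"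
      using True by (intro edge_prob_start) auto
    ultimately show ?thesis using True steps.emeasure_space_1 by auto
  next
    case False
    then have "{\<omega>. s ## \<omega> \<in> edge_event B x y (eSuc m) z} = edge_event B x y m (z + s)"
      using z by (auto simp: edge_event_SCons)
    then show ?thesis unfolding edge_prob_def using False by simp
  qed
  then show ?thesis
    unfolding edge_prob_def[of _ _ _ "eSuc m"] nbr_mean_def
    by (subst emeasure_steps) auto
qed

lemma edge_prob_SUP: "edge_prob B x y \<infinity> z = (SUP m. edge_prob B x y (enat m) z)"
proof -
  have "(\<Union>m. edge_event B x y (enat m) z) = edge_event B x y \<infinity> z"
    by (auto simp: edge_event_def)
  then show ?thesis unfolding edge_prob_def
  proof (subst SUP_emeasure_incseq)
    show "range (\<lambda>m. edge_event B x y (enat m) z) \<subseteq> sets steps" by auto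
    show "incseq (\<lambda>m. edge_event B x y (enat m) z)"
      by (rule monoI) (fastforce simp: edge_event_def intro: less_le_trans)
  qed simp
qed

lemma edge_prob_leI:
  assumes "\<And>m. edge_prob B x y (enat m) z \<le> c"
  shows "edge_prob B x y \<infinity> z \<le> c"
  unfolding edge_prob_SUP using assms by (rule SUP_least)

lemma measure_edge_event: "ennreal (measure steps (edge_event B x y m z)) = edge_prob B x y m z"
  by (simp add: edge_prob_def steps.emeasure_eq_measure)

lemma in_level_iff: "z \<in> level n \<longleftrightarrow> snd z = int n"
  by (cases z) (auto simp: level_def)

lemma snd_unit_step: "s \<in> unit_steps \<Longrightarrow> \<bar>snd s\<bar> \<le> 1"
  by (auto simp: unit_steps_def)

lemma edge_prob_mono: "m \<le> m' \<Longrightarrow> edge_prob B x y m z \<le> edge_prob B x y m' z"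
  unfolding edge_prob_def
  by (intro emeasure_mono sets_edge_event) (auto simp: edge_event_def intro: less_le_trans)

section \<open>Decomposition at the first visit to a level above the cluster\<close>

lemma nn_integral_level_point:
  fixes f :: "int \<Rightarrow> ennreal" and N :: int
  assumes "snd z = N"
  shows "(\<integral>\<^sup>+w. (if z - (w, N) = 0 then 1 else 0) * f w \<partial>count_space UNIV) = f (fst z)"
proof -
  have "(\<integral>\<^sup>+w. (if z - (w, N) = 0 then 1 else 0) * f w \<partial>count_space UNIV)
      = (\<Sum>w\<in>{fst z}. (if z - (w, N) = 0 then 1 else 0) * f w)"
    by (rule nn_integral_count_space') (auto simp: prod_eq_iff)
  then show ?thesis using assms by (cases z) (auto simp: zero_prod_def)
qed

lemma nbr_mean_level_mixture:
  fixes N :: int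
  shows "nbr_mean (\<lambda>u. \<integral>\<^sup>+w. g (u - (w, N)) * f w \<partial>count_space UNIV) z =
    (\<integral>\<^sup>+w. nbr_mean g (z - (w, N)) * f w \<partial>count_space UNIV)"
  unfolding nbr_mean_nn_integral mult.commute[of _ "f _"] nbr_mean_cmult nbr_mean_translate ..

context
  fixes B :: "pt set" and N :: nat and x y :: pt
  assumes below: "\<And>b. b \<in> B \<Longrightarrow> snd b < int N" and N_pos: "N \<ge> 1" and x: "x \<in> B"
begin

lemma above_notin: "snd z \<ge> int N \<Longrightarrow> z \<notin> B \<union> level 0"
  using below[of z] N_pos by (auto simp: in_level_iff)

text \<open>Neighbours of a point strictly above level \<open>N\<close> are on or above that level,
  whereas \<open>x\<close> lies below it; hence the source term of \<open>edge_prob_eSuc\<close>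
  vanishes.\<close>

lemma edge_prob_above:
  assumes "snd z > int N"
  shows "edge_prob B x y (eSuc m) z = nbr_mean (edge_prob B x y m) z"
proof -
  have "edge_prob B x y (eSuc m) z =
    nbr_mean (\<lambda>u. (if z = y \<and> u = x \<and> x \<in> B \<union> level 0 then 1 else 0) + edge_prob B x y m u) z"
    using assms by (intro edge_prob_eSuc above_notin) simp
  also have "\<dots> = nbr_mean (edge_prob B x y m) z"
  proof (rule nbr_mean_cong)
    fix s assume "s \<in> unit_steps"
    then have "snd (z + s) \<ge> int N" using assms snd_unit_step[of s] by simp
    then have "z + s \<noteq> x" using below[OF x] by auto
    then show "(if z = y \<and> z + s = x \<and> x \<in> B \<union> level 0 then 1 else 0)
        + edge_prob B x y m (z + s) = edge_prob B x y m (z + s)" by simp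
  qed
  finally show ?thesis .
qed

text \<open>This is the strong Markov property at the first visit to level \<open>N\<close>. Both
  sides are harmonic above the level and agree on it. By induction, truncations of either side stay
  below the full other side, and they increase to their own full side; the two inductions do the
  work of a uniqueness theorem on the unbounded region.\<close>

lemma edge_prob_via_level:
  assumes "snd z \<ge> int N"
  shows "edge_prob B x y \<infinity> z =
    (\<integral>\<^sup>+w. line_hit (z - (w, int N)) * edge_prob B x y \<infinity> (w, int N) \<partial>count_space UNIV)"
proof -
  let ?e = "\<lambda>w. edge_prob B x y \<infinity> (w, int N)"
  define R where "R = (\<lambda>z. \<integral>\<^sup>+w. line_hit (z - (w, int N)) * ?e w \<partial>count_space UNIV)"
  have R_level: "R z = edge_prob B x y \<infinity> z" if "snd z = int N" for z
  proof -
    have "R z = (\<integral>\<^sup>+w. (if z - (w, int N) = 0 then 1 else 0) * ?e w \<partial>count_space UNIV)"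
      unfolding R_def using that by (intro nn_integral_cong) (simp add: line_hit_boundary)
    also have "\<dots> = ?e (fst z)" by (rule nn_integral_level_point) (fact that)
    finally show ?thesis using that by (cases z) simp
  qed
  have R_harmonic: "R z = nbr_mean R z" if "snd z > int N" for z
  proof -
    have "R z = (\<integral>\<^sup>+w. nbr_mean line_hit (z - (w, int N)) * ?e w \<partial>count_space UNIV)"
      unfolding R_def using that by (intro nn_integral_cong) (simp add: line_hit_harmonic)
    also have "\<dots> = nbr_mean R z"
      unfolding R_def by (rule nbr_mean_level_mixture[of line_hit "int N" ?e z, symmetric])
    finally show ?thesis .
  qed
  have upper: "edge_prob B x y (enat m) z \<le> R z" if "snd z \<ge> int N" for m z
    using that
  proof (induction m arbitrary: z)
    case 0
    then show ?case by (simp add: edge_prob_0 zero_enat_def[symmetric])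
  next
    case (Suc m)
    show ?case
    proof (cases "snd z = int N")
      case True
      then show ?thesis unfolding R_level[OF True] by (intro edge_prob_mono) simp
    next
      case False
      with Suc.prems have z: "snd z > int N" by simp
      have "nbr_mean (edge_prob B x y (enat m)) z \<le> nbr_mean R z"
        using z snd_unit_step by (intro nbr_mean_mono Suc.IH) fastforce
      then show ?thesis
        using edge_prob_above[OF z, of "enat m"] R_harmonic[OF z] by (simp add: eSuc_enat)
    qed
  qed
  have lower: "(\<integral>\<^sup>+w. line_hit_upto n (z - (w, int N)) * ?e w \<partial>count_space UNIV)
      \<le> edge_prob B x y \<infinity> z" if "snd z \<ge> int N" for n z
    using that
  proof (induction n arbitrary: z)
    case 0
    show ?case
    proof (cases "snd z = int N")
      case True
      then show ?thesis using nn_integral_level_point[OF True, of ?e] by (cases z) simp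
    next
      case False
      then have "z - (w, int N) \<noteq> 0" for w by (auto simp: prod_eq_iff)
      then show ?thesis by simp
    qed
  next
    case (Suc n)
    show ?case
    proof (cases "snd z = int N")
      case True
      then show ?thesis using nn_integral_level_point[OF True, of ?e] by (cases z) simp
    next
      case False
      with Suc.prems have z: "snd z > int N" by simp
      then have "(\<integral>\<^sup>+w. line_hit_upto (Suc n) (z - (w, int N)) * ?e w \<partial>count_space UNIV)
          = nbr_mean (\<lambda>u. \<integral>\<^sup>+w. line_hit_upto n (u - (w, int N)) * ?e w \<partial>count_space UNIV) z"
        unfolding nbr_mean_level_mixture[of "line_hit_upto n" "int N" ?e z]
        by (intro nn_integral_cong) simp
      also have "\<dots> \<le> nbr_mean (edge_prob B x y \<infinity>) z"
        using z snd_unit_step by (intro nbr_mean_mono Suc.IH) fastforce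
      finally show ?thesis using edge_prob_above[OF z, of \<infinity>] by simp
    qed
  qed
  have "R z = (\<integral>\<^sup>+w. (SUP n. line_hit_upto n (z - (w, int N)) * ?e w) \<partial>count_space UNIV)"
    unfolding R_def line_hit_def by (simp add: SUP_mult_right_ennreal)
  also have "\<dots> = (SUP n. \<integral>\<^sup>+w. line_hit_upto n (z - (w, int N)) * ?e w \<partial>count_space UNIV)"
    by (rule nn_integral_monotone_convergence_SUP)
      (auto intro!: incseq_SucI le_funI mult_right_mono line_hit_upto_Suc_mono simp del: line_hit_upto.simps)
  also have "\<dots> \<le> edge_prob B x y \<infinity> z"
    using assms by (intro SUP_least lower)
  finally show ?thesis
    using edge_prob_leI[OF upper[OF assms]] unfolding R_def by simp
qed

text \<open>After exchanging the sums, each point \<open>(w, N)\<close> carries the weight of all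
  starts one row higher that first land on it. This weight is a row sum of \<open>line_hit\<close>,
  so recurrence makes it 1 and no flux is lost.\<close>

lemma edge_flux_Suc:
  "(\<integral>\<^sup>+a. edge_prob B x y \<infinity> (a, int (Suc N)) \<partial>count_space UNIV) =
   (\<integral>\<^sup>+a. edge_prob B x y \<infinity> (a, int N) \<partial>count_space UNIV)"
proof -
  let ?e = "\<lambda>w. edge_prob B x y \<infinity> (w, int N)"
  have "(\<integral>\<^sup>+a. edge_prob B x y \<infinity> (a, int (Suc N)) \<partial>count_space UNIV) =
    (\<integral>\<^sup>+a. \<integral>\<^sup>+w. (\<lambda>(a, w). line_hit (a - w, 1) * ?e w) (a, w) \<partial>count_space UNIV \<partial>count_space UNIV)"
    by (intro nn_integral_cong) (subst edge_prob_via_level, simp_all)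
  also have "\<dots> = (\<integral>\<^sup>+w. \<integral>\<^sup>+a. (\<lambda>(a, w). line_hit (a - w, 1) * ?e w) (a, w) \<partial>count_space UNIV \<partial>count_space UNIV)"
    by (simp only: nn_integral_fst_count_space nn_integral_snd_count_space)
  also have "\<dots> = (\<integral>\<^sup>+w. (\<integral>\<^sup>+a. line_hit (a + (-w), int 1) \<partial>count_space UNIV) * ?e w \<partial>count_space UNIV)"
    by (simp add: nn_integral_multc)
  also have "\<dots> = (\<integral>\<^sup>+w. ?e w \<partial>count_space UNIV)"
    unfolding nn_integral_int_shift[of "\<lambda>k. line_hit (k, int 1)"] line_hit_row_sum by simp
  finally show ?thesis .
qed

end

lemma edge_flux_eq:
  assumes "\<And>b. b \<in> B \<Longrightarrow> snd b < int N" "N \<ge> 1" "x \<in> B" "N \<le> N'"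
  shows "(\<integral>\<^sup>+a. edge_prob B x y \<infinity> (a, int N') \<partial>count_space UNIV) =
   (\<integral>\<^sup>+a. edge_prob B x y \<infinity> (a, int N) \<partial>count_space UNIV)"
  using assms(4)
proof (induction N' rule: dec_induct)
  case (step n)
  have "(\<integral>\<^sup>+a. edge_prob B x y \<infinity> (a, int (Suc n)) \<partial>count_space UNIV) =
   (\<integral>\<^sup>+a. edge_prob B x y \<infinity> (a, int n) \<partial>count_space UNIV)"
  proof (rule edge_flux_Suc)
    show "snd b < int n" if "b \<in> B" for b using assms(1)[OF that] step by simp
  qed (use assms step in auto)
  with step show ?case by simp
qed simp

section \<open>A harmonic majorant of the hitting probability of a box\<close>

text \<open>The chance that the walk first meets the axis within distance \<open>2 * H\<close> of
  the origin; the segment is the bottom side of the comparison box of height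
  \<open>H\<close>.\<close>

definition segment_hit :: "int \<Rightarrow> pt \<Rightarrow> ennreal" where
  "segment_hit H z = (\<Sum>w\<in>{-2*H..2*H}. line_hit (z - (w, 0)))"

lemma segment_hit_harmonic:
  assumes "snd z > 0"
  shows "segment_hit H z = nbr_mean (segment_hit H) z"
proof -
  have "segment_hit H z = (\<Sum>w\<in>{-2*H..2*H}. nbr_mean (\<lambda>u. line_hit (u - (w, 0))) z)"
    unfolding segment_hit_def using assms
    by (intro sum.cong refl) (simp add: line_hit_harmonic nbr_mean_translate)
  also have "\<dots> = nbr_mean (segment_hit H) z"
    unfolding segment_hit_def nbr_mean_sum ..
  finally show ?thesis .
qed

lemma segment_hit_boundary:
  assumes "\<bar>k\<bar> \<le> 2 * H"
  shows "segment_hit H (k, 0) = 1"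
proof -
  have "segment_hit H (k, 0) = (\<Sum>w\<in>{-2*H..2*H}. if w = k then 1 else 0)"
    unfolding segment_hit_def
    by (intro sum.cong refl) (auto simp: line_hit_boundary zero_prod_def)
  then show ?thesis using assms by auto
qed

lemma segment_hit_row_sum:
  assumes "H \<ge> 0"
  shows "(\<integral>\<^sup>+k. segment_hit H (k, int n) \<partial>count_space UNIV) = ennreal (4 * H + 1)"
proof -
  have "(\<integral>\<^sup>+k. segment_hit H (k, int n) \<partial>count_space UNIV) =
      (\<Sum>w\<in>{-2*H..2*H}. \<integral>\<^sup>+k. line_hit (k + (-w), int n) \<partial>count_space UNIV)"
    unfolding segment_hit_def by (simp add: nn_integral_sum)
  also have "\<dots> = of_nat (card {-2*H..2*H})"
    unfolding nn_integral_int_shift[of "\<lambda>k. line_hit (k, int n)"] line_hit_row_sum by simp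
  also have "\<dots> = ennreal (real (card {-2*H..2*H}))"
    by (simp add: ennreal_of_nat_eq_real_of_nat)
  also have "real (card {-2*H..2*H}) = 4 * H + 1" using assms by simp
  finally show ?thesis .
qed

lemma segment_hit_finite: "segment_hit H z \<noteq> \<infinity>"
proof -
  have "line_hit z \<noteq> \<infinity>" for z
    using line_hit_le_1[of z] by (auto simp: top_unique)
  then show ?thesis by (simp add: segment_hit_def)
qed

text \<open>
  Comparison on the box with the strictly subharmonic quadratic
  \<open>(1 - y/H)\<^sup>2 - (x/(2H))\<^sup>2\<close>, which is at most 1 on the bottom side and at most 0 on the others.
\<close>

lemma segment_hit_ge_quadratic:
  fixes H k h :: int
  assumes H: "H > 0" and k: "\<bar>k\<bar> \<le> 2 * H" and h: "0 \<le> h" "h \<le> H"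
  shows "(1 - h / H)\<^sup>2 - (k / (2 * H))\<^sup>2 \<le> enn2real (segment_hit H (k, h))"
proof -
  define v where "v = (\<lambda>(k::int, h::int). (1 - h / H)\<^sup>2 - (k / (2 * H))\<^sup>2)"
  define g where "g = (\<lambda>z. enn2real (segment_hit H z))"
  have G: "segment_hit H z = ennreal (g z)" for z
    unfolding g_def using segment_hit_finite[of H z]
    by (subst ennreal_enn2real) (auto simp: less_top)
  have g0: "0 \<le> g z" for z by (simp add: g_def)
  define S where "S = {-2*H..2*H} \<times> {0..H}"
  have fin: "finite S" by (simp add: S_def)
  have kh: "(k, h) \<in> S" using k h by (auto simp: S_def)
  then have "Max ((\<lambda>q. v q - g q) ` S) \<in> (\<lambda>q. v q - g q) ` S"
    using fin by (intro Max_in) auto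
  \<comment> \<open>Maximum principle: \<open>p\<close> maximises the difference over the finite
    box, so it suffices that the difference is at most 0 at \<open>p\<close>.\<close>
  then obtain p where "Max ((\<lambda>q. v q - g q) ` S) = v p - g p" and p: "p \<in> S" by (rule imageE)
  then have pmax: "v q - g q \<le> v p - g p" if "q \<in> S" for q
  proof -
    have "v q - g q \<le> Max ((\<lambda>q. v q - g q) ` S)" using fin that by (intro Max_ge) auto
    then show ?thesis using \<open>Max _ = _\<close> by simp
  qed
  obtain a b where ab: "p = (a, b)" by (cases p)
  have "v p - g p \<le> 0"
  proof -
    have "- (2 * H) \<le> a" "a \<le> 2 * H" "0 \<le> b" "b \<le> H" using p by (auto simp: ab S_def)
    then consider "b = 0" | "b = H" | "\<bar>a\<bar> = 2 * H" "0 \<le> b" "b \<le> H" | "\<bar>a\<bar> < 2 * H" "0 < b" "b < H"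
      by linarith
    then show ?thesis
    proof cases
      case 1
      have "\<bar>a\<bar> \<le> 2 * H" using \<open>- (2 * H) \<le> a\<close> \<open>a \<le> 2 * H\<close> by linarith
      then have "g p = 1" using 1 by (simp add: g_def ab segment_hit_boundary)
      moreover have "v p \<le> 1" using 1 by (simp add: v_def ab)
      ultimately show ?thesis by simp
    next
      case 2
      then have "v p \<le> 0" using H by (simp add: v_def ab)
      then show ?thesis using g0[of p] by simp
    next
      case 3
      then have "a = 2 * H \<or> a = - (2 * H)" by linarith
      then have "(real_of_int a)\<^sup>2 = (2 * real_of_int H)\<^sup>2" by (auto simp: power_mult_distrib)
      then have "(a / (2 * H))\<^sup>2 = 1" using H by (simp add: power_divide)
      moreover have "(1 - b / H)\<^sup>2 \<le> 1" using 3 H by (intro power_le_one) auto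
      ultimately show ?thesis using g0[of p] by (simp add: v_def ab)
    next
      case 4
      have "ennreal (g p) = nbr_mean (\<lambda>z. ennreal (g z)) p"
        unfolding G[symmetric] using 4 by (intro segment_hit_harmonic) (simp add: ab)
      also have "\<dots> = ennreal ((g (a+1,b) + g (a-1,b) + g (a,b+1) + g (a,b-1)) / 4)"
        using g0 by (simp add: nbr_mean_def sum_unit_steps ab ennreal_plus[symmetric]
            divide_ennreal[symmetric] ennreal_numeral[symmetric] del: ennreal_plus ennreal_numeral)
      finally have gp: "g p = (g (a+1,b) + g (a-1,b) + g (a,b+1) + g (a,b-1)) / 4"
        using g0 by (subst (asm) ennreal_inj) auto
      define c where "c = 1 / real_of_int H"
      have v_eq: "v q = (1 - c * snd q)\<^sup>2 - (c * fst q / 2)\<^sup>2" for q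
        by (simp add: v_def c_def case_prod_beta mult.commute)
      \<comment> \<open>The neighbour mean exceeds the value by \<open>c\<^sup>2 / 2\<close> for the
        vertical square and by \<open>c\<^sup>2 / 8\<close> for the horizontal one, hence by
        \<open>3 * c\<^sup>2 / 8\<close> for \<open>v\<close>. As \<open>g\<close> is harmonic,
        \<open>p\<close> cannot be an interior maximum.\<close>
      have vp: "v p = (v (a+1,b) + v (a-1,b) + v (a,b+1) + v (a,b-1)) / 4 - 3 * c\<^sup>2 / 8"
        unfolding v_eq ab by (simp add: power2_eq_square field_simps)
      have "v (a+1,b) - g (a+1,b) \<le> v p - g p" "v (a-1,b) - g (a-1,b) \<le> v p - g p"
        "v (a,b+1) - g (a,b+1) \<le> v p - g p" "v (a,b-1) - g (a,b-1) \<le> v p - g p"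
        using 4 by (auto intro!: pmax simp: S_def)
      moreover have "c\<^sup>2 > 0" using H by (simp add: c_def)
      ultimately have False using gp vp by argo
      then show ?thesis ..
    qed
  qed
  then have "v (k, h) - g (k, h) \<le> 0" using pmax[OF kh] by simp
  then show ?thesis by (simp add: v_def g_def)
qed

definition box :: "int \<Rightarrow> pt set" where
  "box R = {-R..R} \<times> {0..R}"

text \<open>With \<open>H = 2 * R\<close> the box sits well inside the comparison region: the first
  square is at least 1/4, the second at most 1/16, and the difference 3/16 gives the constant
  16/3.\<close>

lemma segment_hit_box:
  assumes R: "R \<ge> 1" and z: "z \<in> box R"
  shows "1 \<le> ennreal (16 / 3) * segment_hit (2 * R) z"
proof -
  obtain k h where kh: "z = (k, h)" by (cases z)
  with z have k: "\<bar>k\<bar> \<le> R" and h: "0 \<le> h" "h \<le> R" by (auto simp: box_def)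
  have "1 - h / (2 * R) \<ge> 1 / 2" using h R by (simp add: field_simps)
  then have "(1 - h / (2 * R))\<^sup>2 \<ge> (1 / 2)\<^sup>2" by (intro power_mono) auto
  then have "(1 - h / (2 * R))\<^sup>2 \<ge> 1 / 4" by (simp only: power_one_over) simp
  moreover have "\<bar>k / (4 * R)\<bar> \<le> 1 / 4" using k R by (simp add: field_simps)
  then have "(k / (4 * R))\<^sup>2 \<le> (1 / 4)\<^sup>2" by (subst abs_le_square_iff[symmetric]) auto
  then have "(k / (4 * R))\<^sup>2 \<le> 1 / 16" by (simp only: power_one_over) simp
  ultimately have "3 / 16 \<le> (1 - h / (2 * R))\<^sup>2 - (k / (4 * R))\<^sup>2"
    by linarith
  also have "\<dots> \<le> enn2real (segment_hit (2 * R) z)"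
    using segment_hit_ge_quadratic[of "2 * R" k h] k h R unfolding kh by simp
  finally have "ennreal (3 / 16) \<le> segment_hit (2 * R) z"
    by (metis enn2real_nonneg ennreal_enn2real_if ennreal_leI top_greatest)
  then have "ennreal (16 / 3) * ennreal (3 / 16) \<le> ennreal (16 / 3) * segment_hit (2 * R) z"
    by (intro mult_left_mono) auto
  then show ?thesis by (simp add: ennreal_mult[symmetric])
qed

text \<open>Induction on the truncation. If a neighbour lies in \<open>B\<close>, the walk stops
  there, only one edge can have been traversed, and the majorant is at least 1; otherwise the
  induction hypothesis applies. Harmonicity of the majorant closes the step.\<close>

lemma sum_edge_prob_le:
  assumes R: "R \<ge> 1" and B: "B \<subseteq> box R" and E: "finite E" "\<And>x y. (x, y) \<in> E \<Longrightarrow> x \<in> B"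
    and z: "snd z \<ge> 0"
  shows "(\<Sum>(x, y)\<in>E. edge_prob B x y (enat m) z) \<le> ennreal (16 / 3) * segment_hit (2 * R) z"
  using z
proof (induction m arbitrary: z)
  case 0
  then show ?case by (simp add: edge_prob_0 zero_enat_def[symmetric] case_prod_beta)
next
  case (Suc m)
  let ?G = "\<lambda>u. ennreal (16 / 3) * segment_hit (2 * R) u"
  let ?f = "\<lambda>x y u. (if z = y \<and> u = x \<and> x \<in> B \<union> level 0 then 1 else 0) + edge_prob B x y (enat m) u"
  show ?case
  proof (cases "z \<in> B \<union> level 0")
    case True
    then show ?thesis by (simp add: edge_prob_start case_prod_beta)
  next
    case False
    with Suc.prems have pos: "snd z > 0" by (auto simp: in_level_iff)
    have "(\<Sum>(x, y)\<in>E. edge_prob B x y (enat (Suc m)) z)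
        = nbr_mean (\<lambda>u. \<Sum>(x, y)\<in>E. ?f x y u) z"
      unfolding eSuc_enat[symmetric] edge_prob_eSuc[OF False] case_prod_beta nbr_mean_sum ..
    also have "\<dots> \<le> nbr_mean ?G z"
    proof (rule nbr_mean_mono)
      fix s assume s: "s \<in> unit_steps"
      let ?u = "z + s"
      show "(\<Sum>(x, y)\<in>E. ?f x y ?u) \<le> ?G ?u"
      proof (cases "?u \<in> B")
        case True
        then have "(\<Sum>(x, y)\<in>E. ?f x y ?u) \<le> (\<Sum>e\<in>E. if e = (?u, z) then 1 else 0)"
          by (intro sum_mono) (auto simp: edge_prob_start split: if_splits)
        also have "\<dots> \<le> 1" using E(1) by simp
        also have "\<dots> \<le> ?G ?u" using True B by (intro segment_hit_box R) auto
        finally show ?thesis .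
      next
        case False
        then have "(\<Sum>(x, y)\<in>E. ?f x y ?u) = (\<Sum>(x, y)\<in>E. edge_prob B x y (enat m) ?u)"
          using E(2) by (intro sum.cong) auto
        also have "\<dots> \<le> ?G ?u"
          using pos snd_unit_step[OF s] by (intro Suc.IH) simp
        finally show ?thesis .
      qed
    qed
    also have "\<dots> = ?G z"
      unfolding nbr_mean_cmult segment_hit_harmonic[OF pos, symmetric] ..
    finally show ?thesis .
  qed
qed

text \<open>At every height the row sum of \<open>segment_hit (2 * R)\<close> is the number
  \<open>8 * R + 1\<close> of points of its segment; hence a bound uniform in \<open>N\<close> and
  in the number of edges.\<close>

lemma sum_edge_flux_le:
  assumes R: "R \<ge> 1" and B: "B \<subseteq> box R" and E: "finite E" "\<And>x y. (x, y) \<in> E \<Longrightarrow> x \<in> B"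
  shows "(\<Sum>(x, y)\<in>E. \<integral>\<^sup>+a. edge_prob B x y \<infinity> (a, int N) \<partial>count_space UNIV)
    \<le> ennreal (16 / 3 * (8 * R + 1))"
proof -
  have "(\<Sum>(x, y)\<in>E. edge_prob B x y \<infinity> z) \<le> ennreal (16 / 3) * segment_hit (2 * R) z"
    if "snd z \<ge> 0" for z
  proof -
    have "(\<Sum>(x, y)\<in>E. edge_prob B x y \<infinity> z) = (SUP m. \<Sum>(x, y)\<in>E. edge_prob B x y (enat m) z)"
      unfolding edge_prob_SUP case_prod_beta
      by (intro ennreal_SUP_sum[symmetric]) (auto simp: incseq_def intro!: edge_prob_mono)
    also have "\<dots> \<le> ennreal (16 / 3) * segment_hit (2 * R) z"
      by (intro SUP_least sum_edge_prob_le assms that)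
    finally show ?thesis .
  qed
  then have "(\<integral>\<^sup>+a. (\<Sum>(x, y)\<in>E. edge_prob B x y \<infinity> (a, int N)) \<partial>count_space UNIV) \<le>
      (\<integral>\<^sup>+a. ennreal (16 / 3) * segment_hit (2 * R) (a, int N) \<partial>count_space UNIV)"
    by (intro nn_integral_mono) simp
  also have "\<dots> = ennreal (16 / 3) * ennreal (4 * (2 * R) + 1)"
    using R by (subst nn_integral_cmult) (simp_all add: segment_hit_row_sum)
  also have "\<dots> = ennreal (16 / 3 * (4 * (2 * R) + 1))"
    using R by (subst ennreal_mult[symmetric]) auto
  also have "\<dots> = ennreal (16 / 3 * (8 * R + 1))" by simp
  finally show ?thesis by (simp add: nn_integral_sum case_prod_beta)
qed

section \<open>Bounds for the growth rates\<close>

text \<open>Returns from \<open>ennreal\<close> to the real sums of the definitions. Finiteness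
  matters, because \<open>infsum\<close> is 0 by default on a family that is not summable.\<close>

lemma infsum_eq_enn2real_nn_integral:
  fixes f :: "'a \<Rightarrow> real"
  assumes nonneg: "\<And>x. f x \<ge> 0" and finite: "(\<integral>\<^sup>+x. ennreal (f x) \<partial>count_space UNIV) \<noteq> \<infinity>"
  shows "infsum f UNIV = enn2real (\<integral>\<^sup>+x. ennreal (f x) \<partial>count_space UNIV)"
proof -
  have "integrable (count_space UNIV) f"
    using finite by (intro integrableI_nonneg) (auto simp: nonneg less_top)
  then have "infsetsum f UNIV = infsum f UNIV"
    by (intro infsetsum_infsum) (simp add: Infinite_Set_Sum.abs_summable_on_def)
  then show ?thesis
    unfolding infsetsum_def using nonneg by (subst (asm) integral_eq_nn_integral) auto
qed

lemma finite_subset_box: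
  assumes "finite B" "B \<subseteq> half_plane"
  obtains R where "R \<ge> 1" "B \<subseteq> box R"
proof
  let ?R = "1 + (\<Sum>b\<in>B. \<bar>fst b\<bar> + \<bar>snd b\<bar>)"
  show "?R \<ge> 1" by (simp add: sum_nonneg)
  show "B \<subseteq> box ?R"
  proof
    fix b assume b: "b \<in> B"
    have "\<bar>fst b\<bar> + \<bar>snd b\<bar> \<le> (\<Sum>b\<in>B. \<bar>fst b\<bar> + \<bar>snd b\<bar>)"
      using assms(1) b by (intro member_le_sum) auto
    moreover have "snd b \<ge> 0" using b assms(2) by (auto simp: half_plane_def)
    ultimately show "b \<in> box ?R" by (cases b) (auto simp: box_def)
  qed
qed

lemma box_below: "B \<subseteq> box R \<Longrightarrow> R \<ge> 1 \<Longrightarrow> b \<in> B \<Longrightarrow> snd b < int (nat (R + 1))"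
  by (force simp: box_def)

lemma edge_flux_finite:
  assumes "R \<ge> 1" "B \<subseteq> box R" "x \<in> B"
  shows "(\<integral>\<^sup>+a. edge_prob B x y \<infinity> (a, int N) \<partial>count_space UNIV) \<noteq> \<infinity>"
  using sum_edge_flux_le[OF assms(1,2), of "{(x, y)}" N] assms(3) by (auto simp: top_unique)

lemma edge_harm_N_eq:
  assumes B: "R \<ge> 1" "B \<subseteq> box R" "x \<in> B" and below: "\<And>b. b \<in> B \<Longrightarrow> snd b < int N"
  shows "edge_harm_N B N x y = enn2real (\<integral>\<^sup>+a. edge_prob B x y \<infinity> (a, int N) \<partial>count_space UNIV)"
proof -
  let ?f = "\<lambda>z. measure steps (edge_event B x y \<infinity> z)"
  have "level N - B = level N" using below by (fastforce simp: in_level_iff)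
  then have "edge_harm_N B N x y = infsum ?f (level N)"
    by (simp add: edge_harm_N_def edge_event_def)
  also have "level N = range (\<lambda>a. (a, int N))" by (auto simp: level_def)
  also have "infsum ?f (range (\<lambda>a. (a, int N))) = infsum (\<lambda>a. ?f (a, int N)) UNIV"
    by (subst infsum_reindex) (auto simp: inj_on_def o_def)
  also have "\<dots> = enn2real (\<integral>\<^sup>+a. edge_prob B x y \<infinity> (a, int N) \<partial>count_space UNIV)"
    using edge_flux_finite[OF B]
    by (subst infsum_eq_enn2real_nn_integral) (simp_all add: measure_edge_event)
  finally show ?thesis .
qed

text \<open>The sequence is constant once the level lies above \<open>B\<close>, so
  \<open>lim\<close> is a genuine limit and can be read off at any such level.\<close>

lemma edge_harm_eq:
  assumes B: "R \<ge> 1" "B \<subseteq> box R" "x \<in> B"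
    and below: "\<And>b. b \<in> B \<Longrightarrow> snd b < int N" and N: "N \<ge> 1"
  shows "ennreal (edge_harm B x y) = (\<integral>\<^sup>+a. edge_prob B x y \<infinity> (a, int N) \<partial>count_space UNIV)"
    and "edge_harm B x y \<ge> 0"
proof -
  let ?I = "\<lambda>N. \<integral>\<^sup>+a. edge_prob B x y \<infinity> (a, int N) \<partial>count_space UNIV"
  have "\<forall>\<^sub>F n in sequentially. edge_harm_N B n x y = enn2real (?I N)"
    using eventually_ge_at_top[of N]
  proof eventually_elim
    case (elim n)
    have "edge_harm_N B n x y = enn2real (?I n)"
      using elim below by (intro edge_harm_N_eq[OF B]) fastforce
    also have "?I n = ?I N" using B elim by (intro edge_flux_eq below N)
    finally show ?case .
  qed
  then have "edge_harm B x y = enn2real (?I N)"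
    unfolding edge_harm_def by (intro limI tendsto_eventually)
  then show "ennreal (edge_harm B x y) = ?I N" "edge_harm B x y \<ge> 0"
    using edge_flux_finite[OF B, of y N] by (simp_all add: less_top)
qed

lemma edge_harm_nonneg:
  assumes "R \<ge> 1" "B \<subseteq> box R" "x \<in> B"
  shows "edge_harm B x y \<ge> 0"
  using assms by (intro edge_harm_eq(2)[of R B x "nat (R + 1)"] box_below) auto

lemma adjacent_iff: "adjacent x y \<longleftrightarrow> y - x \<in> unit_steps"
  by (cases x; cases y) (auto simp: adjacent_def pt_norm_def unit_steps_def)

lemma finite_outer_boundary: "finite B \<Longrightarrow> finite (outer_boundary B)"
proof -
  assume "finite B"
  have "outer_boundary B \<subseteq> (\<Union>x\<in>B. (\<lambda>s. x + s) ` unit_steps)"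
  proof
    fix y assume "y \<in> outer_boundary B"
    then obtain x where "x \<in> B" "y - x \<in> unit_steps"
      by (auto simp: outer_boundary_def adjacent_iff)
    moreover have "y = x + (y - x)" by simp
    ultimately show "y \<in> (\<Union>x\<in>B. (\<lambda>s. x + s) ` unit_steps)" by blast
  qed
  then show ?thesis by (rule finite_subset) (use \<open>finite B\<close> in auto)
qed

lemma point_harm_nonneg:
  assumes "finite B" "B \<subseteq> half_plane"
  shows "point_harm B y \<ge> 0"
proof -
  obtain R where "R \<ge> 1" "B \<subseteq> box R" using finite_subset_box[OF assms] .
  then show ?thesis unfolding point_harm_def by (auto intro!: sum_nonneg edge_harm_nonneg)
qed

text \<open>The edges are collected in one finite set before estimating; a bound edge by edge would
  multiply the result by the number of boundary edges and lose linearity in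
  \<open>R\<close>.\<close>

lemma total_harm_le_box:
  assumes B: "R \<ge> 1" "B \<subseteq> box R"
  shows "total_harm B \<le> 16 / 3 * (8 * real_of_int R + 1)"
proof -
  have finB: "finite B" using B(2) by (rule finite_subset) (simp add: box_def)
  let ?D = "SIGMA y:outer_boundary B. {x. x \<in> B \<and> adjacent x y}"
  define N where "N = nat (R + 1)"
  have below: "snd b < int N" if "b \<in> B" for b
    unfolding N_def by (rule box_below[OF B(2,1) that])
  have N: "N \<ge> 1" using B by (simp add: N_def)
  have finD: "finite ?D" using finB by (intro finite_SigmaI finite_outer_boundary) auto
  have "total_harm B = (\<Sum>y\<in>outer_boundary B. \<Sum>x | x \<in> B \<and> adjacent x y. edge_harm B x y)"
    by (simp add: total_harm_def point_harm_def)
  also have "\<dots> = (\<Sum>(y, x)\<in>?D. edge_harm B x y)"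
    using finB by (intro sum.Sigma finite_outer_boundary) auto
  finally have total: "total_harm B = (\<Sum>(y, x)\<in>?D. edge_harm B x y)" .
  have "ennreal (total_harm B) = (\<Sum>(y, x)\<in>?D. ennreal (edge_harm B x y))"
    unfolding total case_prod_beta
    by (intro sum_ennreal[symmetric] edge_harm_nonneg[OF B]) auto
  also have "\<dots> = (\<Sum>(y, x)\<in>?D. \<integral>\<^sup>+a. edge_prob B x y \<infinity> (a, int N) \<partial>count_space UNIV)"
    by (intro sum.cong refl) (auto intro!: edge_harm_eq(1)[OF B] below N)
  also have "\<dots> = (\<Sum>(x, y)\<in>prod.swap ` ?D. \<integral>\<^sup>+a. edge_prob B x y \<infinity> (a, int N) \<partial>count_space UNIV)"
    by (subst sum.reindex) (auto simp: case_prod_beta)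
  also have "\<dots> \<le> ennreal (16 / 3 * (8 * real_of_int R + 1))"
    using finD by (intro sum_edge_flux_le B) auto
  finally show ?thesis using B(1) by (simp add: ennreal_le_iff)
qed

lemma total_harm_le:
  assumes "B \<subseteq> half_plane" "\<And>b. b \<in> B \<Longrightarrow> pt_norm b \<le> n"
  shows "total_harm B \<le> 48 * (real n + 1)"
proof -
  \<comment> \<open>Radius \<open>n + 1\<close> meets the condition \<open>R \<ge> 1\<close> also
    for \<open>n = 0\<close>. The constant 48 is \<open>16 / 3 * (8 * 1 + 1)\<close>, the bound in
    that case.\<close>
  have "B \<subseteq> box (int n + 1)"
  proof
    fix b assume "b \<in> B"
    then have "snd b \<ge> 0" "pt_norm b \<le> n" using assms by (auto simp: half_plane_def)
    then show "b \<in> box (int n + 1)" by (cases b) (auto simp: pt_norm_def box_def)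
  qed
  from total_harm_le_box[OF _ this] have "total_harm B \<le> 16 / 3 * (8 * (real n + 1) + 1)" by simp
  also have "\<dots> \<le> 48 * (real n + 1)" by simp
  finally show ?thesis .
qed

section \<open>Positivity of the total rate\<close>

lemma edge_harm_top_pos:
  assumes B: "R \<ge> 1" "B \<subseteq> box R" and a: "a \<in> B" and top: "\<And>b. b \<in> B \<Longrightarrow> snd b \<le> snd a"
  shows "edge_harm B a (a + (0, 1)) > 0"
proof -
  let ?y = "a + (0, 1)" and ?N = "nat (snd a + 1)"
  have "snd a \<ge> 0" using a B by (auto simp: box_def)
  then have N: "int ?N = snd ?y" "?N \<ge> 1" by auto
  have below: "snd b < int ?N" if "b \<in> B" for b using top[OF that] N by simp
  have y: "?y \<notin> B \<union> level 0"
    using N top[of ?y] by (auto simp: in_level_iff)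
  let ?f = "\<lambda>u. (if ?y = ?y \<and> u = a \<and> a \<in> B \<union> level 0 then 1 else 0) + edge_prob B a ?y \<infinity> u"
  \<comment> \<open>The start directly above \<open>a\<close> is itself on level \<open>?N\<close>,
    and one downward step, of probability 1/4, traverses the edge.\<close>
  have "1 / 4 \<le> (\<Sum>s\<in>unit_steps. ?f (?y + s)) / 4"
  proof (rule divide_right_mono_ennreal)
    have "?y + (0, -1) = a" by (cases a) simp
    then have "1 \<le> ?f (?y + (0, -1))" using a by auto
    also have "\<dots> \<le> (\<Sum>s\<in>unit_steps. ?f (?y + s))"
      by (rule member_le_sum) (auto simp: unit_steps_def)
    finally show "1 \<le> (\<Sum>s\<in>unit_steps. ?f (?y + s))" .
  qed
  also have "\<dots> = edge_prob B a ?y \<infinity> ?y"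
    using edge_prob_eSuc[OF y, of a ?y \<infinity>] by (simp add: nbr_mean_def)
  also have "?y = (fst a, int ?N)" using N by (simp add: prod_eq_iff)
  also have "edge_prob B a (fst a, int ?N) \<infinity> (fst a, int ?N)
      = (\<integral>\<^sup>+k. edge_prob B a ?y \<infinity> (k, int ?N) * indicator {fst a} k \<partial>count_space UNIV)"
    unfolding \<open>?y = _\<close> by (subst nn_integral_indicator_singleton) auto
  also have "\<dots> \<le> (\<integral>\<^sup>+k. edge_prob B a ?y \<infinity> (k, int ?N) \<partial>count_space UNIV)"
    by (intro nn_integral_mono) (auto split: split_indicator)
  also have "\<dots> = ennreal (edge_harm B a ?y)"
    by (intro edge_harm_eq(1)[OF B a, symmetric] below N)
  finally have "0 < ennreal (edge_harm B a ?y)"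
    by (rule less_le_trans[rotated]) (simp add: ennreal_zero_less_divide)
  then show ?thesis by simp
qed

text \<open>Guards the division in \<open>growth_prob\<close>: with total rate 0 all quotients would
  be 0 and the jump probabilities would not add up to 1.\<close>

lemma total_harm_pos:
  assumes B: "finite B" "B \<subseteq> half_plane" "B \<noteq> {}"
  shows "total_harm B > 0"
proof -
  obtain R where R: "R \<ge> 1" "B \<subseteq> box R" using finite_subset_box[OF B(1,2)] .
  have "Max (snd ` B) \<in> snd ` B" using B by (intro Max_in) auto
  then obtain a where "Max (snd ` B) = snd a" and a: "a \<in> B" by (rule imageE)
  then have top: "snd b \<le> snd a" if "b \<in> B" for b
    using B(1) that by (metis Max_ge finite_imageI imageI)
  let ?y = "a + (0, 1)"
  have adj: "adjacent a ?y" by (simp add: adjacent_iff unit_steps_def)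
  then have y: "?y \<in> outer_boundary B"
    using a top[of ?y] B(2) by (force simp: outer_boundary_def half_plane_def)
  have "0 < edge_harm B a ?y" by (rule edge_harm_top_pos[OF R a top])
  also have "\<dots> \<le> (\<Sum>x | x \<in> B \<and> adjacent x ?y. edge_harm B x ?y)"
    using a adj B(1) by (intro member_le_sum edge_harm_nonneg[OF R]) auto
  also have "\<dots> = point_harm B ?y" using y by (simp add: point_harm_def)
  also have "\<dots> \<le> total_harm B"
    unfolding total_harm_def
    using y B(1) by (intro member_le_sum point_harm_nonneg B finite_outer_boundary) auto
  finally show ?thesis .
qed

section \<open>The growth paths of the jump chain\<close>

text \<open>Entries after index \<open>n\<close> are fixed as empty, so a path is determined by its
  first \<open>n + 1\<close> states and the possible paths form a finite set to sum over.\<close>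

primrec growth_paths :: "nat \<Rightarrow> (nat \<Rightarrow> pt set) set" where
  "growth_paths 0 = {\<lambda>i. if i = 0 then {(0, 0)} else {}}"
| "growth_paths (Suc n) = (\<lambda>(a, y). a(Suc n := insert y (a n))) `
     (SIGMA a:growth_paths n. outer_boundary (a n))"

lemma outer_boundary_norm:
  assumes "\<And>b. b \<in> B \<Longrightarrow> pt_norm b \<le> n" "y \<in> outer_boundary B"
  shows "pt_norm y \<le> Suc n"
proof -
  obtain x where x: "x \<in> B" "pt_norm (x - y) = 1"
    using assms(2) by (auto simp: outer_boundary_def adjacent_def)
  have "pt_norm y \<le> pt_norm x + pt_norm (x - y)"
    by (cases x; cases y) (auto simp: pt_norm_def)
  moreover have "pt_norm x \<le> n" using x(1) by (rule assms(1))
  ultimately show ?thesis using x(2) by simp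
qed

lemma growth_paths_SucE:
  assumes "a \<in> growth_paths (Suc n)"
  obtains b y where "b \<in> growth_paths n" "y \<in> outer_boundary (b n)" "a = b(Suc n := insert y (b n))"
  using assms that by auto

lemma growth_paths_beyond: "a \<in> growth_paths n \<Longrightarrow> n < i \<Longrightarrow> a i = {}"
proof (induction n arbitrary: a)
  case (Suc n)
  from Suc.prems(1) show ?case by (rule growth_paths_SucE) (use Suc in simp)
qed simp

lemma growth_paths_0: "a \<in> growth_paths n \<Longrightarrow> a 0 = {(0, 0)}"
proof (induction n arbitrary: a)
  case (Suc n)
  from Suc.prems(1) show ?case by (rule growth_paths_SucE) (use Suc in simp)
qed simp

lemma growth_paths_cluster:
  "a \<in> growth_paths n \<Longrightarrow> i \<le> n \<Longrightarrow>
    finite (a i) \<and> a i \<noteq> {} \<and> a i \<subseteq> half_plane \<and> (\<forall>b\<in>a i. pt_norm b \<le> i)"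
proof (induction n arbitrary: a i)
  case 0
  then show ?case by (auto simp: half_plane_def pt_norm_def)
next
  case (Suc n)
  from Suc.prems(1) obtain b y where b: "b \<in> growth_paths n" and y: "y \<in> outer_boundary (b n)"
    and a: "a = b(Suc n := insert y (b n))" by (rule growth_paths_SucE)
  show ?case
  proof (cases "i = Suc n")
    case True
    have bn: "finite (b n) \<and> b n \<noteq> {} \<and> b n \<subseteq> half_plane \<and> (\<forall>c\<in>b n. pt_norm c \<le> n)"
      using Suc.IH[OF b] by simp
    moreover have "pt_norm y \<le> Suc n" using bn y by (intro outer_boundary_norm) auto
    moreover have "y \<in> half_plane" using y by (simp add: outer_boundary_def)
    ultimately show ?thesis using True a by (auto intro: le_SucI)
  next
    case False
    with Suc.prems have "i \<le> n" by simp
    then show ?thesis using Suc.IH[OF b] False a by simp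
  qed
qed

lemma finite_growth_paths: "finite (growth_paths n)"
proof (induction n)
  case (Suc n)
  have "finite (outer_boundary (a n))" if "a \<in> growth_paths n" for a
    using growth_paths_cluster[OF that] by (intro finite_outer_boundary) auto
  with Suc show ?case by (auto intro!: finite_imageI finite_SigmaI)
qed simp

lemma growth_paths_eqI:
  assumes "a \<in> growth_paths n" "b \<in> growth_paths n" "\<And>i. i \<le> n \<Longrightarrow> a i = b i"
  shows "a = b"
proof
  fix i
  show "a i = b i"
    using assms growth_paths_beyond[of a n i] growth_paths_beyond[of b n i] by (cases "i \<le> n") auto
qed

text \<open>A boundary point lies outside the current cluster, so the added point can be recovered
  from the last two states. This permits reindexing sums over paths.\<close>

lemma inj_on_growth_step:
  "inj_on (\<lambda>(a, y). a(Suc n := insert y (a n))) (SIGMA a:growth_paths n. outer_boundary (a n))"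
proof (rule inj_onI, clarify)
  fix a y b z
  assume a: "a \<in> growth_paths n" and b: "b \<in> growth_paths n"
    and y: "y \<in> outer_boundary (a n)" and z: "z \<in> outer_boundary (b n)"
    and eq: "a(Suc n := insert y (a n)) = b(Suc n := insert z (b n))"
  have "a = b"
  proof (rule growth_paths_eqI[OF a b])
    fix i assume "i \<le> n"
    then show "a i = b i" using fun_cong[OF eq, of i] by simp
  qed
  moreover have "insert y (a n) = insert z (b n)" using fun_cong[OF eq, of "Suc n"] by simp
  ultimately show "a = b \<and> y = z" using y z by (auto simp: outer_boundary_def)
qed

lemma total_harm_nonneg: "finite B \<Longrightarrow> B \<subseteq> half_plane \<Longrightarrow> total_harm B \<ge> 0"
  unfolding total_harm_def by (intro sum_nonneg point_harm_nonneg)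

lemma jump_prob_insert: "y \<in> outer_boundary A \<Longrightarrow> jump_prob A (insert y A) = growth_prob A y"
proof -
  assume y: "y \<in> outer_boundary A"
  then have "{y' \<in> outer_boundary A. insert y A = insert y' A} = {y}"
    by (auto simp: outer_boundary_def)
  then show ?thesis by (simp add: jump_prob_def)
qed

lemma jump_prob_nonneg: "finite A \<Longrightarrow> A \<subseteq> half_plane \<Longrightarrow> jump_prob A A' \<ge> 0"
  unfolding jump_prob_def growth_prob_def
  by (intro sum_nonneg divide_nonneg_nonneg point_harm_nonneg total_harm_nonneg)

lemma sum_growth_prob:
  assumes "finite A" "A \<subseteq> half_plane" "A \<noteq> {}"
  shows "(\<Sum>y\<in>outer_boundary A. growth_prob A y) = 1"
  using total_harm_pos[OF assms]
  by (simp add: growth_prob_def sum_divide_distrib[symmetric] total_harm_def[symmetric])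

text \<open>Summing out the last jump leaves a factor 1. Hence these finitely many paths carry the
  whole law of the chain, whatever other values \<open>Y\<close> may formally take.\<close>

lemma sum_growth_paths:
  "(\<Sum>a\<in>growth_paths n. \<Prod>i<n. jump_prob (a i) (a (Suc i))) = 1"
proof (induction n)
  case 0
  then show ?case by simp
next
  case (Suc n)
  let ?p = "\<lambda>n a. \<Prod>i<n. jump_prob (a i) (a (Suc i))"
  have cl: "finite (a n)" "a n \<subseteq> half_plane" "a n \<noteq> {}" if "a \<in> growth_paths n" for a
    using growth_paths_cluster[OF that, of n] by auto
  have step: "?p (Suc n) (a(Suc n := insert y (a n))) = ?p n a * growth_prob (a n) y"
    if "y \<in> outer_boundary (a n)" for a y
    using that by (simp add: jump_prob_insert)
  have "(\<Sum>a\<in>growth_paths (Suc n). ?p (Suc n) a)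
      = sum (?p (Suc n) \<circ> (\<lambda>(a, y). a(Suc n := insert y (a n)))) (SIGMA a:growth_paths n. outer_boundary (a n))"
    by (simp only: growth_paths.simps sum.reindex[OF inj_on_growth_step])
  also have "\<dots> = (\<Sum>(a, y)\<in>(SIGMA a:growth_paths n. outer_boundary (a n)). ?p n a * growth_prob (a n) y)"
  proof (intro sum.cong refl, clarify)
    fix a y assume "y \<in> outer_boundary (a n)"
    then show "(?p (Suc n) \<circ> (\<lambda>(a, y). a(Suc n := insert y (a n)))) (a, y)
        = ?p n a * growth_prob (a n) y" by (simp only: o_def prod.case step)
  qed
  also have "\<dots> = (\<Sum>a\<in>growth_paths n. \<Sum>y\<in>outer_boundary (a n). ?p n a * growth_prob (a n) y)"
    by (intro sum.Sigma[symmetric] finite_growth_paths ballI finite_outer_boundary cl)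
  also have "\<dots> = (\<Sum>a\<in>growth_paths n. ?p n a)"
    by (intro sum.cong refl) (simp add: sum_distrib_left[symmetric] sum_growth_prob cl)
  finally show ?case using Suc by simp
qed

section \<open>Tail bounds for the jump times\<close>

lemma prod_of_bool:
  "finite I \<Longrightarrow> (\<Prod>i\<in>I. of_bool (P i)) = (of_bool (\<forall>i\<in>I. P i) :: 'a::comm_semiring_1)"
  by (induction I rule: finite_induct) auto

locale jump_chain = prob_space M for M :: "'w measure" +
  fixes Y :: "nat \<Rightarrow> 'w \<Rightarrow> pt set" and T :: "nat \<Rightarrow> 'w \<Rightarrow> real"
  assumes jump_chain: "jump_chain_holding_times M Y T"
begin

lemma measurable_T [measurable]: "T n \<in> borel_measurable M"
  using jump_chain by (simp add: jump_chain_holding_times_def)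

lemma pred_Y [measurable]: "Measurable.pred M (\<lambda>\<omega>. Y n \<omega> = A)"
proof -
  have "Y n \<in> measurable M (count_space clusters)"
    using jump_chain by (simp add: jump_chain_holding_times_def)
  then show ?thesis by (rule measurable_compose) simp
qed

text \<open>Positivity of the holding times is included because the joint law speaks of strict
  tails: thresholds 0 give exactly this event, with the probability of the path alone.\<close>

definition path_event :: "(nat \<Rightarrow> pt set) \<Rightarrow> nat \<Rightarrow> 'w set" where
  "path_event a n = {\<omega> \<in> space M. (\<forall>i\<le>n. Y i \<omega> = a i) \<and> (\<forall>i<n. T i \<omega> > 0)}"

lemma sets_path_event [measurable]: "path_event a n \<in> sets M"
  unfolding path_event_def by measurable

lemma prob_holding_times:
  assumes "\<And>i. s i \<ge> 0"
  shows "prob {\<omega> \<in> space M. (\<forall>i\<le>n. Y i \<omega> = a i) \<and> (\<forall>i<n. T i \<omega> > s i)} =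
        (if a 0 = {(0, 0)} then 1 else 0) *
        (\<Prod>i<n. jump_prob (a i) (a (Suc i)) * exp (- total_harm (a i) * s i))"
  using jump_chain assms unfolding jump_chain_holding_times_def by blast

text \<open>The joint law evaluates products of tail indicators, whereas the Chernoff weights are
  combinations of two of them. The induction replaces one indicator at a time; \<open>r\<close>
  stays arbitrary so that the hypothesis can be used twice per step.\<close>

lemma has_integral_holding_time_weights:
  assumes s: "\<And>i. s i \<ge> 0" and "k \<le> n" and "\<And>i. r i \<ge> 0"
  shows "has_bochner_integral M
    (\<lambda>\<omega>. of_bool (\<forall>i\<le>n. Y i \<omega> = a i)
       * (\<Prod>i<k. of_bool (T i \<omega> > 0) - p i * of_bool (T i \<omega> > s i))
       * (\<Prod>i=k..<n. of_bool (T i \<omega> > r i)))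
    ((if a 0 = {(0, 0)} then 1 else 0)
       * (\<Prod>i<k. jump_prob (a i) (a (Suc i)) * (1 - p i * exp (- total_harm (a i) * s i)))
       * (\<Prod>i=k..<n. jump_prob (a i) (a (Suc i)) * exp (- total_harm (a i) * r i)))"
  using assms(2,3)
proof (induction k arbitrary: r)
  case 0
  let ?A = "{\<omega> \<in> space M. (\<forall>i\<le>n. Y i \<omega> = a i) \<and> (\<forall>i<n. T i \<omega> > r i)}"
  have "has_bochner_integral M (indicator ?A) (prob ?A)"
    by (rule has_bochner_integral_real_indicator) (simp_all add: emeasure_eq_measure less_top[symmetric])
  then show ?case
    unfolding prob_holding_times[OF 0(2)]
    by (rule has_bochner_integral_cong[THEN iffD1, rotated -1])
      (auto simp: prod_of_bool atLeast0LessThan indicator_def)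
next
  case (Suc k)
  let ?J = "\<lambda>i. jump_prob (a i) (a (Suc i))"
  let ?c = "if a 0 = {(0, 0)} then 1 else 0 :: real"
  let ?W = "\<lambda>k \<omega>. \<Prod>i<k. of_bool (T i \<omega> > 0) - p i * of_bool (T i \<omega> > s i)"
  let ?V = "\<lambda>k. \<Prod>i<k. ?J i * (1 - p i * exp (- total_harm (a i) * s i))"
  let ?f = "\<lambda>k r \<omega>. of_bool (\<forall>i\<le>n. Y i \<omega> = a i) * ?W k \<omega> * (\<Prod>i=k..<n. of_bool (T i \<omega> > r i))"
  let ?x = "\<lambda>k r. ?c * ?V k * (\<Prod>i=k..<n. ?J i * exp (- total_harm (a i) * r i))"
  have IH: "has_bochner_integral M (?f k (r(k := u))) (?x k (r(k := u)))" if "u \<ge> 0" for u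
    using Suc.prems that by (intro Suc.IH) auto
  have k: "k < n" using Suc.prems by simp
  have f: "?f k (r(k := u)) \<omega> = of_bool (\<forall>i\<le>n. Y i \<omega> = a i) * ?W k \<omega> *
      (of_bool (T k \<omega> > u) * (\<Prod>i=Suc k..<n. of_bool (T i \<omega> > r i)))" for u \<omega>
    unfolding prod.atLeast_Suc_lessThan[OF k]
    by (intro arg_cong2[where f="(*)"] refl prod.cong) auto
  have x: "?x k (r(k := u)) = ?c * ?V k *
      ((?J k * exp (- total_harm (a k) * u)) * (\<Prod>i=Suc k..<n. ?J i * exp (- total_harm (a i) * r i)))" for u
    unfolding prod.atLeast_Suc_lessThan[OF k]
    by (intro arg_cong2[where f="(*)"] refl prod.cong) auto
  \<comment> \<open>Threshold 0 minus \<open>p k\<close> times threshold \<open>s k\<close> produces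
    the weight of index \<open>k\<close>, in the integrand and in the value alike.\<close>
  have "has_bochner_integral M (\<lambda>\<omega>. ?f k (r(k := 0)) \<omega> - p k * ?f k (r(k := s k)) \<omega>)
      (?x k (r(k := 0)) - p k * ?x k (r(k := s k)))"
    by (intro has_bochner_integral_diff has_bochner_integral_mult_right IH s order_refl)
  then show ?case
    unfolding f x by (simp add: algebra_simps)
qed

lemma prob_path_event:
  assumes "a 0 = {(0, 0)}"
  shows "prob (path_event a n) = (\<Prod>i<n. jump_prob (a i) (a (Suc i)))"
  using prob_holding_times[of "\<lambda>_. 0" n a] assms by (simp add: path_event_def)

lemma AE_path_event: "AE \<omega> in M. \<exists>a\<in>growth_paths n. \<omega> \<in> path_event a n"
proof -
  have disj: "disjoint_family_on (\<lambda>a. path_event a n) (growth_paths n)"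
    unfolding disjoint_family_on_def
  proof (intro ballI impI)
    fix a b assume "a \<in> growth_paths n" "b \<in> growth_paths n" "a \<noteq> b"
    then obtain i where "i \<le> n" "a i \<noteq> b i" using growth_paths_eqI by blast
    then show "path_event a n \<inter> path_event b n = {}" by (auto simp: path_event_def)
  qed
  have "prob (\<Union>a\<in>growth_paths n. path_event a n) = (\<Sum>a\<in>growth_paths n. prob (path_event a n))"
    by (intro finite_measure_finite_Union finite_growth_paths disj) auto
  also have "\<dots> = (\<Sum>a\<in>growth_paths n. \<Prod>i<n. jump_prob (a i) (a (Suc i)))"
    by (intro sum.cong refl prob_path_event growth_paths_0)
  also have "\<dots> = 1" by (rule sum_growth_paths)
  finally have "prob (\<Union>a\<in>growth_paths n. path_event a n) = 1" .
  moreover have "(\<Union>a\<in>growth_paths n. path_event a n) \<in> sets M"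
    by (intro sets.finite_UN finite_growth_paths) auto
  ultimately have "AE \<omega> in M. \<omega> \<in> (\<Union>a\<in>growth_paths n. path_event a n)"
    by (simp add: prob_eq_1)
  then show ?thesis by simp
qed

text \<open>
  Chernoff bound. The holding times are only known through their joint tails, so the exponential
  moment is bounded through the step function \<open>1 - p\<cdot>1{\<tau> > s}\<close>, which dominates \<open>exp (- \<theta> \<tau>)\<close>
  for positive \<open>\<tau>\<close> when \<open>p = 1 - exp (- \<theta> s)\<close>.
\<close>

lemma prob_path_jump_time_le:
  assumes s: "\<And>i. s i \<ge> 0" and \<theta>: "\<theta> \<ge> 0" and a: "a 0 = {(0, 0)}"
  shows "prob (path_event a n \<inter> {\<omega> \<in> space M. (\<Sum>i<n. T i \<omega>) \<le> t}) \<le> exp (\<theta> * t) *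
    (\<Prod>i<n. jump_prob (a i) (a (Suc i)) * (1 - (1 - exp (- \<theta> * s i)) * exp (- total_harm (a i) * s i)))"
    (is "prob ?E \<le> _ * ?P")
proof -
  define p where "p i = 1 - exp (- \<theta> * s i)" for i
  define w where "w i \<tau> = of_bool (\<tau> > 0) - p i * of_bool (\<tau> > s i)" for i and \<tau> :: real
  have p: "0 \<le> p i" "p i \<le> 1" for i using s[of i] \<theta> by (simp_all add: p_def)
  have w0: "0 \<le> w i \<tau>" for i \<tau> using p[of i] s[of i] by (auto simp: w_def)
  have w1: "exp (- \<theta> * \<tau>) \<le> w i \<tau>" if "\<tau> > 0" for i \<tau>
  proof (cases "\<tau> > s i")
    case True
    then have "\<theta> * s i \<le> \<theta> * \<tau>" using \<theta> by (intro mult_left_mono) auto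
    then show ?thesis using True that by (simp add: w_def p_def)
  qed (use that \<theta> in \<open>simp add: w_def\<close>)
  define f where "f \<omega> = of_bool (\<forall>i\<le>n. Y i \<omega> = a i) * (\<Prod>i<n. w i (T i \<omega>))" for \<omega>
  have f: "has_bochner_integral M f ?P"
    using has_integral_holding_time_weights[of s n n "\<lambda>_. 0" a p] s a
    unfolding f_def w_def p_def by simp
  have "indicator ?E \<omega> \<le> exp (\<theta> * t) * f \<omega>" for \<omega>
  proof (cases "\<omega> \<in> ?E")
    case True
    then have Y: "\<forall>i\<le>n. Y i \<omega> = a i" and T: "\<And>i. i < n \<Longrightarrow> T i \<omega> > 0"
      and sum: "(\<Sum>i<n. T i \<omega>) \<le> t" by (auto simp: path_event_def)
    have "1 \<le> exp (\<theta> * t) * exp (- \<theta> * (\<Sum>i<n. T i \<omega>))"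
      using mult_left_mono[OF sum \<theta>] by (simp add: exp_add[symmetric])
    also have "exp (- \<theta> * (\<Sum>i<n. T i \<omega>)) = (\<Prod>i<n. exp (- \<theta> * T i \<omega>))"
      by (simp add: sum_distrib_left exp_sum)
    also have "\<dots> \<le> (\<Prod>i<n. w i (T i \<omega>))" by (intro prod_mono conjI w1 T) auto
    finally show ?thesis using Y True by (simp add: f_def)
  next
    case False
    then have outside: "indicator ?E \<omega> = (0::real)" by (rule indicator_simps(2))
    have "0 \<le> exp (\<theta> * t) * f \<omega>"
      unfolding f_def by (intro mult_nonneg_nonneg prod_nonneg w0) auto
    then show ?thesis unfolding outside .
  qed
  then have "(\<integral>\<omega>. indicator ?E \<omega> \<partial>M) \<le> (\<integral>\<omega>. exp (\<theta> * t) * f \<omega> \<partial>M)"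
    using f by (intro integral_mono) (auto simp: has_bochner_integral_iff less_top[symmetric])
  then show ?thesis
    using f by (simp add: has_bochner_integral_iff Int_absorb1)
qed

text \<open>On every path, jump \<open>i\<close> contributes a factor at most
  \<open>1 - k / (3 * k + i + 1)\<close>. Bernoulli's inequality turns it into a \<open>k\<close>-th
  power whose product over \<open>i < n\<close> telescopes, and the path probabilities then sum to
  1.\<close>

lemma prob_jump_time_le:
  fixes k :: nat and t :: real
  assumes k: "k \<ge> 1"
  shows "prob {\<omega> \<in> space M. (\<Sum>i<n. T i \<omega>) \<le> t} \<le> exp (144 * k * t) * (3 * k / (3 * real k + n)) ^ k"
proof -
  \<comment> \<open>\<open>s i\<close> is the reciprocal of the rate bound for norm
    \<open>i\<close>, so tails at \<open>s i\<close> are at least \<open>exp (-1)\<close>, hence at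
    least 1/3. In \<open>144 = 3 * 48\<close> the 3 makes up for this 1/3, so that the decay
    exponent is exactly \<open>k\<close>.\<close>
  define \<theta> where "\<theta> = 144 * real k"
  define s where "s i = 1 / (48 * (real i + 1))" for i :: nat
  let ?E = "{\<omega> \<in> space M. (\<Sum>i<n. T i \<omega>) \<le> t}"
  let ?J = "\<lambda>a i. jump_prob (a i) (a (Suc i))"
  have s: "s i \<ge> 0" for i by (simp add: s_def)
  have factor: "1 - (1 - exp (- \<theta> * s i)) * exp (- total_harm (a i) * s i)
      \<le> ((3 * real k + i) / (3 * real k + Suc i)) ^ k"
    and factor_nonneg: "0 \<le> 1 - (1 - exp (- \<theta> * s i)) * exp (- total_harm (a i) * s i)"
    if a: "a \<in> growth_paths n" and i: "i < n" for a i
  proof -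
    have cl: "finite (a i)" "a i \<subseteq> half_plane" "\<And>b. b \<in> a i \<Longrightarrow> pt_norm b \<le> i"
      using growth_paths_cluster[OF a, of i] i by auto
    have "total_harm (a i) * s i \<le> 1"
      using total_harm_le[OF cl(2,3)] by (simp add: s_def field_simps)
    then have "exp (-1) \<le> exp (- total_harm (a i) * s i)" by simp
    moreover have "(1 / 3 :: real) \<le> exp (-1)"
      using exp_le by (simp add: exp_minus field_simps)
    ultimately have e: "1 / 3 \<le> exp (- total_harm (a i) * s i)" by linarith
    have e1: "exp (- total_harm (a i) * s i) \<le> 1"
      using total_harm_nonneg[OF cl(1,2)] s[of i] by simp
    define x where "x = \<theta> * s i"
    have x: "x = 3 * k / (real i + 1)" by (simp add: x_def \<theta>_def s_def field_simps)
    have x0: "x \<ge> 0" by (simp add: x)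
    have "exp (- x) \<le> 1 / (1 + x)"
      using exp_ge_add_one_self[of x] x0 by (simp add: exp_minus field_simps)
    also have "\<dots> = 1 - 3 * k / (3 * real k + Suc i)"
      by (simp add: x field_simps)
    finally have q: "3 * k / (3 * real k + Suc i) \<le> 1 - exp (- \<theta> * s i)" by (simp add: x_def)
    define d where "d = 3 * real k + Suc i"
    have d: "d > 0" by (simp add: d_def)
    have "3 * k / d * (1 / 3) \<le> (1 - exp (- \<theta> * s i)) * exp (- total_harm (a i) * s i)"
      using q e x0 d unfolding d_def[symmetric] by (intro mult_mono) (auto simp: x_def[symmetric])
    then have "1 - (1 - exp (- \<theta> * s i)) * exp (- total_harm (a i) * s i) \<le> 1 + real k * (- (1 / d))"
      by simp
    also have "\<dots> \<le> (1 + - (1 / d)) ^ k"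
      by (rule Bernoulli_inequality) (simp add: d_def)
    also have "1 + - (1 / d) = (3 * real k + i) / d"
      using d by (simp add: d_def field_simps)
    finally show "1 - (1 - exp (- \<theta> * s i)) * exp (- total_harm (a i) * s i)
      \<le> ((3 * real k + i) / (3 * real k + Suc i)) ^ k" by (simp add: d_def)
    show "0 \<le> 1 - (1 - exp (- \<theta> * s i)) * exp (- total_harm (a i) * s i)"
      using e1 x0 by (auto simp: x_def[symmetric] intro!: mult_le_one)
  qed
  have telescope: "(\<Prod>i<n. (3 * real k + i) / (3 * real k + Suc i)) = 3 * k / (3 * real k + n)"
    using k by (induction n) (auto simp: field_simps)
  \<comment> \<open>The event is split along paths because the Chernoff bound needs a prescribed
    sequence of rates.\<close>
  have "AE \<omega> in M. \<omega> \<in> ?E \<longleftrightarrow> \<omega> \<in> (\<Union>a\<in>growth_paths n. path_event a n \<inter> ?E)"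
    using AE_path_event[of n] by eventually_elim auto
  then have "prob ?E = prob (\<Union>a\<in>growth_paths n. path_event a n \<inter> ?E)"
    by (intro finite_measure_eq_AE) (auto intro!: sets.finite_UN finite_growth_paths)
  also have "\<dots> \<le> (\<Sum>a\<in>growth_paths n. prob (path_event a n \<inter> ?E))"
    by (intro finite_measure_subadditive_finite finite_growth_paths) auto
  also have "\<dots> \<le> (\<Sum>a\<in>growth_paths n. exp (\<theta> * t) *
      ((\<Prod>i<n. ?J a i) * (\<Prod>i<n. ((3 * real k + i) / (3 * real k + Suc i)) ^ k)))"
  proof (rule sum_mono)
    fix a assume a: "a \<in> growth_paths n"
    have "prob (path_event a n \<inter> ?E) \<le> exp (\<theta> * t) *
        (\<Prod>i<n. ?J a i * (1 - (1 - exp (- \<theta> * s i)) * exp (- total_harm (a i) * s i)))"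
      by (rule prob_path_jump_time_le) (use s growth_paths_0[OF a] in \<open>auto simp: \<theta>_def\<close>)
    also have "\<dots> \<le> exp (\<theta> * t) * (\<Prod>i<n. ?J a i * ((3 * real k + i) / (3 * real k + Suc i)) ^ k)"
    proof (rule mult_left_mono[OF prod_mono], rule conjI)
      fix i assume "i \<in> {..<n}"
      then have i: "i < n" by simp
      have J: "?J a i \<ge> 0"
        using growth_paths_cluster[OF a, of i] i by (intro jump_prob_nonneg) auto
      show "0 \<le> ?J a i * (1 - (1 - exp (- \<theta> * s i)) * exp (- total_harm (a i) * s i))"
        using J factor_nonneg[OF a i] by (rule mult_nonneg_nonneg)
      show "?J a i * (1 - (1 - exp (- \<theta> * s i)) * exp (- total_harm (a i) * s i))
          \<le> ?J a i * ((3 * real k + i) / (3 * real k + Suc i)) ^ k"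
        using J factor[OF a i] by (intro mult_left_mono)
    qed simp
    finally show "prob (path_event a n \<inter> ?E) \<le> exp (\<theta> * t) *
      ((\<Prod>i<n. ?J a i) * (\<Prod>i<n. ((3 * real k + i) / (3 * real k + Suc i)) ^ k))"
      by (simp only: prod.distrib)
  qed
  also have "\<dots> = exp (\<theta> * t) * (3 * k / (3 * real k + n)) ^ k"
    unfolding sum_distrib_left[symmetric] sum_distrib_right[symmetric] sum_growth_paths
      prod_power_distrib[symmetric] telescope by simp
  finally show ?thesis by (simp add: \<theta>_def)
qed

end

section \<open>Moments of the norm at a fixed time\<close>

theorem theorem6:
  fixes M :: "'w measure" and A :: "real \<Rightarrow> 'w \<Rightarrow> pt set" and m :: nat and t :: real
  assumes "ct_dla M A" and "m \<ge> 1" and "t \<ge> 0"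
  shows "integrable M (\<lambda>\<omega>. real (set_norm (A t \<omega>)) ^ m)"
proof -
  obtain Y T where "prob_space M" and jc: "jump_chain_holding_times M Y T"
    and A_eq: "AE \<omega> in M. \<forall>t\<ge>0. \<forall>n.
           (\<Sum>i<n. T i \<omega>) \<le> t \<and> t < (\<Sum>i<Suc n. T i \<omega>) \<longrightarrow> A t \<omega> = Y n \<omega>"
    and A_meas: "A t \<in> measurable M (count_space clusters)"
    using assms(1,3) unfolding ct_dla_def by blast
  then interpret jump_chain M Y T
    by (simp add: jump_chain_def jump_chain_axioms_def)
  define E where "E n = {\<omega> \<in> space M. (\<Sum>i<n. T i \<omega>) \<le> t}" for n
  have sets_E [measurable]: "E n \<in> sets M" for n unfolding E_def by measurable
  \<comment> \<open>Two powers beyond \<open>m\<close> leave a summable inverse square after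
    multiplication by \<open>n ^ m\<close>.\<close>
  define k where "k = m + 2"
  define c where "c = exp (144 * k * t) * (3 * real k) ^ k"
  have c: "c \<ge> 0" by (simp add: c_def)
  have bound: "real n ^ m * prob (E n) \<le> c * inverse (real (Suc n) ^ 2)"
    and bound': "prob (E n) \<le> c * inverse (real (Suc n) ^ 2)" for n
  proof -
    have le: "prob (E n) \<le> c / (3 * real k + n) ^ k"
      using prob_jump_time_le[of k n t] by (simp add: E_def c_def k_def power_divide)
    also have "\<dots> \<le> c / real (Suc n) ^ k"
      using c by (intro divide_left_mono power_mono mult_pos_pos zero_less_power) (auto simp: k_def)
    finally have le: "prob (E n) \<le> c / (real (Suc n) ^ m * real (Suc n) ^ 2)"
      by (simp only: k_def power_add)
    have "real n ^ m * prob (E n) \<le> real (Suc n) ^ m * (c / (real (Suc n) ^ m * real (Suc n) ^ 2))"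
      by (intro mult_mono power_mono le) auto
    also have "\<dots> = c * inverse (real (Suc n) ^ 2)" by (simp add: field_simps del: of_nat_Suc)
    finally show "real n ^ m * prob (E n) \<le> c * inverse (real (Suc n) ^ 2)" .
    have "1 * prob (E n) \<le> real (Suc n) ^ m * (c / (real (Suc n) ^ m * real (Suc n) ^ 2))"
      by (intro mult_mono le one_le_power) auto
    also have "\<dots> = c * inverse (real (Suc n) ^ 2)" by (simp add: field_simps del: of_nat_Suc)
    finally show "prob (E n) \<le> c * inverse (real (Suc n) ^ 2)" by simp
  qed
  have summable_bound: "summable (\<lambda>n. c * inverse (real (Suc n) ^ 2))"
    by (intro summable_mult) (subst summable_Suc_iff, rule inverse_power_summable, simp)
  have "summable (\<lambda>n. prob (E n))"
    by (rule summable_comparison_test'[OF summable_bound, of 0]) (use bound' in simp)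
  then have no_explosion: "AE \<omega> in M. eventually (\<lambda>n. \<omega> \<in> space M - E n) sequentially"
    by (intro borel_cantelli_AE1) (auto simp: emeasure_eq_measure)
  have "AE \<omega> in M. \<forall>n. \<exists>a\<in>growth_paths n. \<omega> \<in> path_event a n"
    unfolding AE_all_countable using AE_path_event by blast
  \<comment> \<open>If exactly \<open>j\<close> jumps have occurred by time \<open>t\<close>, then
    \<open>E j\<close> holds and the norm is at most \<open>j\<close>, so the term \<open>j\<close>
    of the series alone dominates. Only the tails of the jump times are then needed, not the law of
    the number of jumps.\<close>
  with no_explosion A_eq have le: "AE \<omega> in M. ennreal (real (set_norm (A t \<omega>)) ^ m)
      \<le> (\<Sum>n. ennreal (real n ^ m) * indicator (E n) \<omega>)"
    using AE_space
  proof eventually_elim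
    case (elim \<omega>)
    then obtain n0 where "\<omega> \<notin> E n0" by (auto simp: eventually_sequentially)
    then have ex: "\<exists>n. t < (\<Sum>i<n. T i \<omega>)" using elim(4) by (auto simp: E_def not_le)
    define l where "l = (LEAST n. t < (\<Sum>i<n. T i \<omega>))"
    have l: "t < (\<Sum>i<l. T i \<omega>)" unfolding l_def by (rule LeastI_ex) (rule ex)
    \<comment> \<open>The empty sum is 0, hence not above \<open>t\<close>; so the least index is a
      successor, and its predecessor numbers the current state.\<close>
    with assms(3) obtain j where j: "l = Suc j" by (cases l) auto
    have "\<not> t < (\<Sum>i<j. T i \<omega>)" by (rule not_less_Least) (simp add: l_def[symmetric] j)
    then have le: "(\<Sum>i<j. T i \<omega>) \<le> t" by simp
    have "A t \<omega> = Y j \<omega>" using elim(2) assms(3) l le unfolding j by blast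
    moreover obtain a where a: "a \<in> growth_paths j" "\<omega> \<in> path_event a j" using elim(3) by blast
    ultimately have "A t \<omega> = a j" by (simp add: path_event_def)
    then have "set_norm (A t \<omega>) \<le> j"
      using growth_paths_cluster[OF a(1), of j] by (simp add: set_norm_def)
    then have "ennreal (real (set_norm (A t \<omega>)) ^ m) \<le> ennreal (real j ^ m)"
      by (intro ennreal_leI power_mono) auto
    also have "\<dots> = (\<Sum>n\<in>{j}. ennreal (real n ^ m) * indicator (E n) \<omega>)"
      using le elim(4) by (simp add: E_def)
    also have "\<dots> \<le> (\<Sum>n. ennreal (real n ^ m) * indicator (E n) \<omega>)"
      by (intro sum_le_suminf) auto
    finally show ?case .
  qed
  have meas: "(\<lambda>\<omega>. real (set_norm (A t \<omega>)) ^ m) \<in> borel_measurable M"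
    using A_meas by (rule measurable_compose) simp
  have "(\<integral>\<^sup>+\<omega>. ennreal (real (set_norm (A t \<omega>)) ^ m) \<partial>M)
      \<le> (\<integral>\<^sup>+\<omega>. (\<Sum>n. ennreal (real n ^ m) * indicator (E n) \<omega>) \<partial>M)"
    using le by (rule nn_integral_mono_AE)
  also have "\<dots> = (\<Sum>n. ennreal (real n ^ m * prob (E n)))"
    by (simp add: nn_integral_suminf nn_integral_cmult emeasure_eq_measure ennreal_mult)
  also have "\<dots> \<le> (\<Sum>n. ennreal (c * inverse (real (Suc n) ^ 2)))"
    using bound by (intro suminf_le ennreal_leI) auto
  also have "\<dots> = ennreal (\<Sum>n. c * inverse (real (Suc n) ^ 2))"
    using c by (intro suminf_ennreal2 summable_bound) simp
  also have "\<dots> < \<infinity>" by simp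
  finally show ?thesis
    using meas by (intro integrableI_nonneg) auto
qed

end
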